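(* Let $\{Z(\mathbf{x}), \mathbf{x}\in\mathbb{S}^2\}$ be a (scalar, real, second-order) axially symmetric and mean square continuous random field with covariance function $C(\varphi_1,\varphi_2,\theta)$. Then $C$ is of the form $$C(\varphi_1,\varphi_2,\theta)=\sum_{n=0}^\infty\{b_n(\varphi_1,\varphi_2)\cos(n\theta)+a_n(\varphi_1,\varphi_2)\sin(n\theta)\},\qquad \varphi_1,\varphi_2\in[0,\pi],\ \theta\in[-2\pi,2\pi],$$ where $b_n(\varphi_1,\varphi_2)$ is a covariance function on $[0,\pi]$ for each fixed $n\in\mathbb{N}_0$, and $\sum_{n=0}^\infty b_n(\varphi_1,\varphi_2)$ converges.
   Context: $\mathbb{N}_0$ is the set of nonnegative integers. $\mathbb{S}^2$ is the unit sphere in $\mathbb{R}^3$. Using spherical coordinates, a point $\mathbf{x}\in\mathbb{S}^2$ is determined by its longitude $\theta\in[0,2\pi]$ and latitude $\varphi\in[0,\pi]$ and is designated $\mathbf{x}=(\varphi,\theta)$; correspondingly one writes $Z(\mathbf{x})=Z(\varphi,\theta)$. A real second-order random field $\{Z(\mathbf{x}),\mathbf{x}=(\varphi,\theta)\in\mathbb{S}^2\}$ is axially symmetric if its mean $\mathrm{E}Z(\mathbf{x})$ depends only on $\varphi$ and its covariance $\mathrm{cov}(Z(\mathbf{x}_1),Z(\mathbf{x}_2))$ depends only on $\varphi_1,\varphi_2$ and $\theta_1-\theta_2$, where $\mathbf{x}_k=(\varphi_k,\theta_k)$; it is then written $C(\varphi_1,\varphi_2,\theta_1-\theta_2)$.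 Mean square continuity means $\mathrm{E}|Z(\varphi_1,\theta_1)-Z(\varphi_2,\theta_2)|^2\to0$ as $\varphi_1\to\varphi_2$, $\theta_1\to\theta_2$. A covariance function on $[0,\pi]$ is a function $b(\varphi_1,\varphi_2)$ that is the covariance function of some real second-order stochastic process indexed by $[0,\pi]$. Convergence of $\sum_n b_n(\varphi_1,\varphi_2)$ is for all $\varphi_1,\varphi_2\in[0,\pi]$. *)

theory Defs
  imports "HOL-Probability.Probability"
begin

text \<open>
  As the spherical coordinates are mapped into the unit sphere of \<^typ>\<open>real^3\<close>, a random field
  indexed by that sphere automatically takes one value at each pole and the same value at the
  longitudes \<open>0\<close> and \<open>2 * pi\<close>. Here \<open>\<phi>\<close> is measured from the north pole.
\<close>

definition sphere_point :: "real \<Rightarrow> real \<Rightarrow> real^3" where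
  "sphere_point \<phi> \<theta> = vector [sin \<phi> * cos \<theta>, sin \<phi> * sin \<theta>, cos \<phi>]"

lemma image_sphere_point:
  "(\<lambda>(\<phi>, \<theta>). sphere_point \<phi> \<theta>) ` ({0..pi} \<times> {0..2 * pi}) = sphere 0 1"
proof (intro equalityI subsetI)
  fix x :: "real^3"
  assume "x \<in> (\<lambda>(\<phi>, \<theta>). sphere_point \<phi> \<theta>) ` ({0..pi} \<times> {0..2 * pi})"
  then obtain \<phi> \<theta> where x: "x = sphere_point \<phi> \<theta>" by auto
  have "(norm x)\<^sup>2 = (sin \<phi> * cos \<theta>)\<^sup>2 + (sin \<phi> * sin \<theta>)\<^sup>2 + (cos \<phi>)\<^sup>2"
    unfolding x sphere_point_def power2_norm_eq_inner
    by (simp add: inner_vec_def sum_3 power2_eq_square)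
  also have "\<dots> = (sin \<phi>)\<^sup>2 * ((cos \<theta>)\<^sup>2 + (sin \<theta>)\<^sup>2) + (cos \<phi>)\<^sup>2"
    by (simp only: power_mult_distrib distrib_left)
  also have "\<dots> = 1" by (simp only: sin_cos_squared_add sin_cos_squared_add2 mult_1_right)
  finally show "x \<in> sphere 0 1"
    by (simp add: norm_eq_1 power2_norm_eq_inner)
next
  fix x :: "real^3"
  assume "x \<in> sphere 0 1"
  then have "x \<bullet> x = 1" by (simp add: dot_square_norm)
  then have n: "(x$1)\<^sup>2 + (x$2)\<^sup>2 + (x$3)\<^sup>2 = 1"
    by (simp add: inner_vec_def sum_3 power2_eq_square)
  then have "(x$3)\<^sup>2 \<le> 1" using sum_power2_ge_zero[of "x$1" "x$2"] by linarith
  then have "\<bar>x$3\<bar> \<le> 1" by (simp add: abs_square_le_1)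
  then have z: "-1 \<le> x$3" "x$3 \<le> 1" by auto
  define \<phi> where "\<phi> = arccos (x$3)"
  have \<phi>: "\<phi> \<in> {0..pi}" "cos \<phi> = x$3"
    using z arccos_bounded[of "x$3"] by (auto simp: \<phi>_def)
  have s: "(sin \<phi>)\<^sup>2 = (x$1)\<^sup>2 + (x$2)\<^sup>2"
    using n \<phi>(2) sin_squared_eq[of \<phi>] by simp
  obtain \<theta> where \<theta>: "\<theta> \<in> {0..2 * pi}" "x$1 = sin \<phi> * cos \<theta>" "x$2 = sin \<phi> * sin \<theta>"
  proof (cases "sin \<phi> = 0")
    case True
    then have "x$1 = 0" "x$2 = 0" using s by (auto simp: sum_power2_eq_zero_iff)
    then show ?thesis using that[of 0] True by simp
  next
    case False
    then have "(x$1 / sin \<phi>)\<^sup>2 + (x$2 / sin \<phi>)\<^sup>2 = 1"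
      by (simp only: power_divide add_divide_distrib[symmetric] s[symmetric]) simp
    then obtain t where "0 \<le> t" "t < 2 * pi" "x$1 / sin \<phi> = cos t" "x$2 / sin \<phi> = sin t"
      using sincos_total_2pi by metis
    then show ?thesis using that[of t] False by (simp add: field_simps)
  qed
  have "x = sphere_point \<phi> \<theta>"
    using \<phi> \<theta> by (simp add: sphere_point_def vec_eq_iff forall_3)
  then show "x \<in> (\<lambda>(\<phi>, \<theta>). sphere_point \<phi> \<theta>) ` ({0..pi} \<times> {0..2 * pi})"
    using \<phi> \<theta> by force
qed

definition second_order_process :: "'w measure \<Rightarrow> 't set \<Rightarrow> ('t \<Rightarrow> 'w \<Rightarrow> real) \<Rightarrow> bool" where
  "second_order_process M T X \<longleftrightarrow>
     prob_space M \<and>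
     (\<forall>t\<in>T. X t \<in> borel_measurable M \<and> integrable M (\<lambda>\<omega>. (X t \<omega>)\<^sup>2))"

definition covariance :: "'w measure \<Rightarrow> ('w \<Rightarrow> real) \<Rightarrow> ('w \<Rightarrow> real) \<Rightarrow> real" where
  "covariance M X Y =
     integral\<^sup>L M (\<lambda>\<omega>. (X \<omega> - integral\<^sup>L M X) * (Y \<omega> - integral\<^sup>L M Y))"

text \<open>
  A formula cannot quantify over the type of the sample space. Taking path space \<open>'t \<Rightarrow> real\<close> loses
  nothing: the law of a process on any sample space is a measure on path space, and the coordinate
  process under this law has the same covariances (\<open>covariance_function_onI\<close>).
\<close>

definition covariance_function_on :: "'t set \<Rightarrow> ('t \<Rightarrow> 't \<Rightarrow> real) \<Rightarrow> bool" where
  "covariance_function_on T b \<longleftrightarrow>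
     (\<exists>(M :: ('t \<Rightarrow> real) measure) X. second_order_process M T X \<and>
        (\<forall>s\<in>T. \<forall>t\<in>T. b s t = covariance M (X s) (X t)))"

lemma covariance_function_onI:
  assumes X: "second_order_process M T X"
    and b: "\<And>s t. s \<in> T \<Longrightarrow> t \<in> T \<Longrightarrow> b s t = covariance M (X s) (X t)"
  shows "covariance_function_on T b"
proof -
  let ?P = "PiM T (\<lambda>_. borel :: real measure)"
  let ?F = "\<lambda>\<omega>. \<lambda>t\<in>T. X t \<omega>"
  let ?N = "distr M ?P ?F"
  have meas[measurable]: "X t \<in> borel_measurable M" if "t \<in> T" for t
    using X that by (simp add: second_order_process_def)
  have F[measurable]: "?F \<in> measurable M ?P"
    by (rule measurable_restrict) (rule meas)
  have coord[measurable]: "(\<lambda>p. p t) \<in> borel_measurable ?P" if "t \<in> T" for t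
    using that by (rule measurable_component_singleton)
  have int: "integral\<^sup>L ?N (\<lambda>p. p t) = integral\<^sup>L M (X t)" if t: "t \<in> T" for t
    using t by (subst integral_distr[OF F coord[OF t]]) simp
  have "prob_space ?N"
    using X F by (auto simp: second_order_process_def intro: prob_space.prob_space_distr)
  moreover have "integrable ?N (\<lambda>p. (p t)\<^sup>2)" if t: "t \<in> T" for t
  proof -
    have "(\<lambda>p. (p t)\<^sup>2) \<in> borel_measurable ?P"
      using coord[OF t] by (rule borel_measurable_power)
    then show ?thesis
      using X t by (simp add: integrable_distr_eq[OF F] second_order_process_def)
  qed
  ultimately have "second_order_process ?N T (\<lambda>t p. p t)"
    using coord by (simp add: second_order_process_def)
  moreover have "b s t = covariance ?N (\<lambda>p. p s) (\<lambda>p. p t)" if s: "s \<in> T" and t: "t \<in> T" for s t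
  proof -
    have "(\<lambda>p. (p s - integral\<^sup>L M (X s)) * (p t - integral\<^sup>L M (X t))) \<in> borel_measurable ?P"
      using coord[OF s] coord[OF t] by measurable
    then show ?thesis
      using s t by (simp add: b covariance_def int integral_distr[OF F])
  qed
  ultimately show ?thesis
    unfolding covariance_function_on_def by blast
qed

text \<open>
  Since the longitudes lie in \<open>{0..2 * pi}\<close>, their differences fill \<open>{-2 * pi..2 * pi}\<close>, so that the
  field determines \<open>C\<close> exactly on \<open>{0..pi} \<times> {0..pi} \<times> {-2 * pi..2 * pi}\<close>.
\<close>

definition axial_covariance ::
  "'w measure \<Rightarrow> (real^3 \<Rightarrow> 'w \<Rightarrow> real) \<Rightarrow> (real \<Rightarrow> real \<Rightarrow> real \<Rightarrow> real) \<Rightarrow> bool" where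
  "axial_covariance M Z C \<longleftrightarrow>
     (\<forall>\<phi>1\<in>{0..pi}. \<forall>\<phi>2\<in>{0..pi}. \<forall>\<theta>1\<in>{0..2 * pi}. \<forall>\<theta>2\<in>{0..2 * pi}.
        covariance M (Z (sphere_point \<phi>1 \<theta>1)) (Z (sphere_point \<phi>2 \<theta>2)) = C \<phi>1 \<phi>2 (\<theta>1 - \<theta>2))"

definition axially_symmetric :: "'w measure \<Rightarrow> (real^3 \<Rightarrow> 'w \<Rightarrow> real) \<Rightarrow> bool" where
  "axially_symmetric M Z \<longleftrightarrow>
     (\<exists>m. \<forall>\<phi>\<in>{0..pi}. \<forall>\<theta>\<in>{0..2 * pi}. integral\<^sup>L M (Z (sphere_point \<phi> \<theta>)) = m \<phi>) \<and>
     (\<exists>C. axial_covariance M Z C)"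

definition mean_square_continuous :: "'w measure \<Rightarrow> (real^3 \<Rightarrow> 'w \<Rightarrow> real) \<Rightarrow> bool" where
  "mean_square_continuous M Z \<longleftrightarrow>
     (\<forall>\<phi>2\<in>{0..pi}. \<forall>\<theta>2\<in>{0..2 * pi}.
        ((\<lambda>(\<phi>1, \<theta>1). integral\<^sup>L M
            (\<lambda>\<omega>. \<bar>Z (sphere_point \<phi>1 \<theta>1) \<omega> - Z (sphere_point \<phi>2 \<theta>2) \<omega>\<bar>\<^sup>2))
         \<longlongrightarrow> 0) (at (\<phi>2, \<theta>2) within {0..pi} \<times> {0..2 * pi}))"

end

theory Submission
  imports Defs
begin

text \<open>
  The centred field restricted to parallels is a family of mean square continuous processes on the
  circle whose cross-covariances depend only on the difference of the arguments. The Riemann sums of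
  their \<open>n\<close>-th cosine coefficients over the grids of \<open>2 ^ k\<close> points form Cauchy sequences in \<open>L\<^sup>2\<close>,
  and the second moments of the limits are, up to a factor, the cosine coefficients of \<open>C\<close>; so
  these are covariances. On a grid of \<open>N\<close> points the first \<open>N\<close> cosine coefficients of
  \<open>C \<phi> \<phi>\<close> are nonnegative and add up to \<open>C \<phi> \<phi> 0\<close>, and by the arithmetic-geometric mean inequality
  they dominate the coefficients of \<open>C \<phi>1 \<phi>2\<close>. Hence the Fourier series of \<open>C \<phi>1 \<phi>2\<close> converges
  absolutely, and a continuous function on the circle is determined by its Fourier coefficients.
\<close>

section \<open>Square integrable functions\<close>

definition square_integrable :: "'a measure \<Rightarrow> ('a \<Rightarrow> real) \<Rightarrow> bool" where
  "square_integrable M X \<longleftrightarrow> X \<in> borel_measurable M \<and> integrable M (\<lambda>\<omega>. (X \<omega>)\<^sup>2)"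

lemma square_integrable_measurable:
  "square_integrable M X \<Longrightarrow> X \<in> borel_measurable M"
  by (simp add: square_integrable_def)

lemma integrable_power2:
  "square_integrable M X \<Longrightarrow> integrable M (\<lambda>\<omega>. (X \<omega>)\<^sup>2)"
  by (simp add: square_integrable_def)

lemma integrable_times:
  assumes "square_integrable M X" "square_integrable M Y"
  shows "integrable M (\<lambda>\<omega>. X \<omega> * Y \<omega>)"
proof (rule Bochner_Integration.integrable_bound)
  show "integrable M (\<lambda>\<omega>. (X \<omega>)\<^sup>2 + (Y \<omega>)\<^sup>2)"
    using assms by (simp add: integrable_power2)
  show "(\<lambda>\<omega>. X \<omega> * Y \<omega>) \<in> borel_measurable M"
    using assms by (intro borel_measurable_times square_integrable_measurable)
  have "\<bar>x * y\<bar> \<le> x\<^sup>2 + y\<^sup>2" for x y :: real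
  proof -
    have "2 * \<bar>x\<bar> * \<bar>y\<bar> \<le> x\<^sup>2 + y\<^sup>2"
      using sum_squares_bound[of "\<bar>x\<bar>" "\<bar>y\<bar>"] by simp
    moreover have "0 \<le> \<bar>x\<bar> * \<bar>y\<bar>" by simp
    ultimately show ?thesis unfolding abs_mult by linarith
  qed
  then show "AE \<omega> in M. norm (X \<omega> * Y \<omega>) \<le> norm ((X \<omega>)\<^sup>2 + (Y \<omega>)\<^sup>2)"
    by simp
qed

lemma square_integrable_add:
  assumes "square_integrable M X" "square_integrable M Y"
  shows "square_integrable M (\<lambda>\<omega>. X \<omega> + Y \<omega>)"
  unfolding square_integrable_def
proof
  show "(\<lambda>\<omega>. X \<omega> + Y \<omega>) \<in> borel_measurable M"
    using assms by (intro borel_measurable_add square_integrable_measurable)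
  show "integrable M (\<lambda>\<omega>. (X \<omega> + Y \<omega>)\<^sup>2)"
    using assms integrable_times[OF assms] by (simp add: integrable_power2 power2_sum mult.assoc)
qed

lemma square_integrable_cmult:
  "square_integrable M X \<Longrightarrow> square_integrable M (\<lambda>\<omega>. c * X \<omega>)"
  unfolding square_integrable_def power_mult_distrib
  by (intro conjI borel_measurable_times borel_measurable_const integrable_mult_right) auto

lemma square_integrable_diff:
  assumes "square_integrable M X" "square_integrable M Y"
  shows "square_integrable M (\<lambda>\<omega>. X \<omega> - Y \<omega>)"
  using square_integrable_add[OF assms(1) square_integrable_cmult[OF assms(2), of "-1"]] by simp

lemma square_integrable_sum:
  "(\<And>i. i \<in> I \<Longrightarrow> square_integrable M (X i)) \<Longrightarrow> square_integrable M (\<lambda>\<omega>. \<Sum>i\<in>I. X i \<omega>)"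
proof (induction I rule: infinite_finite_induct)
  case (insert i I)
  then show ?case by (simp add: square_integrable_add)
qed (simp_all add: square_integrable_def)

lemma (in finite_measure) square_integrable_const: "square_integrable M (\<lambda>_. c)"
  by (simp add: square_integrable_def)

text \<open>The free factor \<open>c\<close> serves several uses: \<open>c = 1\<close> and
  \<open>c = -1\<close> give the arithmetic-geometric bound, a general \<open>c\<close> the
  quadratic polynomial behind Cauchy-Schwarz, and \<open>c = 1\<close> again the distance of two
  Riemann sums.\<close>

lemma integral_power2_diff_cmult:
  assumes "square_integrable M X" "square_integrable M Y"
  shows "(\<integral>\<omega>. (X \<omega> - c * Y \<omega>)\<^sup>2 \<partial>M) =
    (\<integral>\<omega>. X \<omega> * X \<omega> \<partial>M) - 2 * c * (\<integral>\<omega>. X \<omega> * Y \<omega> \<partial>M) + c\<^sup>2 * (\<integral>\<omega>. Y \<omega> * Y \<omega> \<partial>M)"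
proof -
  have "(\<integral>\<omega>. (X \<omega> - c * Y \<omega>)\<^sup>2 \<partial>M) =
      (\<integral>\<omega>. X \<omega> * X \<omega> - 2 * c * (X \<omega> * Y \<omega>) + c\<^sup>2 * (Y \<omega> * Y \<omega>) \<partial>M)"
    by (rule Bochner_Integration.integral_cong) (auto simp: power2_eq_square algebra_simps)
  then show ?thesis
    using assms by (simp add: integrable_times)
qed

lemma integral_times_sum:
  assumes "\<And>i. i \<in> I \<Longrightarrow> square_integrable M (X i)" "\<And>j. j \<in> J \<Longrightarrow> square_integrable M (Y j)"
  shows "(\<integral>\<omega>. (\<Sum>i\<in>I. u i * X i \<omega>) * (\<Sum>j\<in>J. v j * Y j \<omega>) \<partial>M) =
    (\<Sum>i\<in>I. \<Sum>j\<in>J. u i * v j * (\<integral>\<omega>. X i \<omega> * Y j \<omega> \<partial>M))"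
proof -
  have "(\<integral>\<omega>. (\<Sum>i\<in>I. u i * X i \<omega>) * (\<Sum>j\<in>J. v j * Y j \<omega>) \<partial>M) =
    (\<integral>\<omega>. (\<Sum>i\<in>I. \<Sum>j\<in>J. u i * v j * (X i \<omega> * Y j \<omega>)) \<partial>M)"
    by (rule Bochner_Integration.integral_cong) (auto simp: sum_product mult_ac)
  also have "\<dots> = (\<Sum>i\<in>I. \<Sum>j\<in>J. u i * v j * (\<integral>\<omega>. X i \<omega> * Y j \<omega> \<partial>M))"
    using assms by (subst Bochner_Integration.integral_sum)
      (auto intro!: Bochner_Integration.integrable_sum sum.cong Bochner_Integration.integral_sum
        integrable_times simp: Bochner_Integration.integral_sum integrable_times)
  finally show ?thesis .
qed

text \<open>Expanding the nonnegative moments of \<open>X - Y\<close> and \<open>X + Y\<close>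
  suffices. Compared with Cauchy-Schwarz, the right side is additive, so that it passes directly to
  summable series.\<close>

lemma two_abs_integral_times_le:
  assumes "square_integrable M X" "square_integrable M Y"
  shows "2 * \<bar>\<integral>\<omega>. X \<omega> * Y \<omega> \<partial>M\<bar> \<le> (\<integral>\<omega>. X \<omega> * X \<omega> \<partial>M) + (\<integral>\<omega>. Y \<omega> * Y \<omega> \<partial>M)"
proof -
  have "0 \<le> (\<integral>\<omega>. (X \<omega> - c * Y \<omega>)\<^sup>2 \<partial>M)" for c
    by simp
  from this[of 1] this[of "-1"] show ?thesis
    unfolding integral_power2_diff_cmult[OF assms] by simp
qed

lemma Cauchy_Schwarz_integral:
  assumes "square_integrable M X" "square_integrable M Y"
  shows "\<bar>\<integral>\<omega>. X \<omega> * Y \<omega> \<partial>M\<bar> \<le> sqrt (\<integral>\<omega>. (X \<omega>)\<^sup>2 \<partial>M) * sqrt (\<integral>\<omega>. (Y \<omega>)\<^sup>2 \<partial>M)"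
proof -
  define a b c where "a = (\<integral>\<omega>. (X \<omega>)\<^sup>2 \<partial>M)" "b = (\<integral>\<omega>. X \<omega> * Y \<omega> \<partial>M)" "c = (\<integral>\<omega>. (Y \<omega>)\<^sup>2 \<partial>M)"
  have nonneg: "0 \<le> a" "0 \<le> c" by (simp_all add: a_b_c_def)
  have quad: "0 \<le> a - 2 * t * b + t\<^sup>2 * c" for t
  proof -
    have "0 \<le> (\<integral>\<omega>. (X \<omega> - t * Y \<omega>)\<^sup>2 \<partial>M)" by simp
    then show ?thesis
      unfolding integral_power2_diff_cmult[OF assms] by (simp add: a_b_c_def power2_eq_square)
  qed
  have "b\<^sup>2 \<le> a * c"
  proof (cases "c = 0")
    case True
    have "b = 0"
    proof (rule ccontr)
      assume "b \<noteq> 0"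
      \<comment> \<open>With \<open>c = 0\<close> the quadratic is linear in \<open>t\<close>; this
        \<open>t\<close> makes it equal to \<open>-1\<close>.\<close>
      then show False using quad[of "(a + 1) / (2 * b)"] True by simp
    qed
    then show ?thesis using True by simp
  next
    case False
    \<comment> \<open>The minimum of the quadratic is attained at \<open>b / c\<close>.\<close>
    then show ?thesis using quad[of "b / c"] nonneg by (simp add: field_simps power2_eq_square)
  qed
  then have "\<bar>b\<bar> \<le> sqrt (a * c)"
    by (metis real_sqrt_abs real_sqrt_le_iff)
  then show ?thesis by (simp add: a_b_c_def real_sqrt_mult)
qed

section \<open>Mean square convergence\<close>

text \<open>Joint continuity of the inner product of \<open>L2\<close>: the difference of the
  products splits into three terms, each bounded by Cauchy-Schwarz. Square integrability is only
  asked eventually, which admits the filter \<open>at t within {0..2 * pi}\<close>.\<close>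

lemma tendsto_integral_times:
  assumes sq: "eventually (\<lambda>k. square_integrable M (X k)) F" "eventually (\<lambda>k. square_integrable M (Y k)) F"
    "square_integrable M A" "square_integrable M B"
    and X: "((\<lambda>k. \<integral>\<omega>. (X k \<omega> - A \<omega>)\<^sup>2 \<partial>M) \<longlongrightarrow> 0) F"
    and Y: "((\<lambda>k. \<integral>\<omega>. (Y k \<omega> - B \<omega>)\<^sup>2 \<partial>M) \<longlongrightarrow> 0) F"
  shows "((\<lambda>k. \<integral>\<omega>. X k \<omega> * Y k \<omega> \<partial>M) \<longlongrightarrow> (\<integral>\<omega>. A \<omega> * B \<omega> \<partial>M)) F"
proof -
  define x y where "x k = sqrt (\<integral>\<omega>. (X k \<omega> - A \<omega>)\<^sup>2 \<partial>M)" "y k = sqrt (\<integral>\<omega>. (Y k \<omega> - B \<omega>)\<^sup>2 \<partial>M)" for k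
  define a b where "a = sqrt (\<integral>\<omega>. (A \<omega>)\<^sup>2 \<partial>M)" "b = sqrt (\<integral>\<omega>. (B \<omega>)\<^sup>2 \<partial>M)"
  have "(x \<longlongrightarrow> sqrt 0) F" "(y \<longlongrightarrow> sqrt 0) F"
    unfolding x_y_def by (rule tendsto_real_sqrt[OF X], rule tendsto_real_sqrt[OF Y])
  then have "(x \<longlongrightarrow> 0) F" "(y \<longlongrightarrow> 0) F" by simp_all
  then have "((\<lambda>k. x k * y k + x k * b + a * y k) \<longlongrightarrow> 0 * 0 + 0 * b + a * 0) F"
    by (intro tendsto_add tendsto_mult tendsto_const)
  then have lim: "((\<lambda>k. x k * y k + x k * b + a * y k) \<longlongrightarrow> 0) F" by simp
  have "eventually (\<lambda>k. norm ((\<integral>\<omega>. X k \<omega> * Y k \<omega> \<partial>M) - (\<integral>\<omega>. A \<omega> * B \<omega> \<partial>M))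
      \<le> x k * y k + x k * b + a * y k) F"
    using sq(1,2)
  proof eventually_elim
    case (elim k)
    note XA = square_integrable_diff[OF elim(1) sq(3)] and YB = square_integrable_diff[OF elim(2) sq(4)]
    have "(\<integral>\<omega>. X k \<omega> * Y k \<omega> \<partial>M) - (\<integral>\<omega>. A \<omega> * B \<omega> \<partial>M)
        = (\<integral>\<omega>. X k \<omega> * Y k \<omega> - A \<omega> * B \<omega> \<partial>M)"
      using elim sq by (simp add: integrable_times)
    also have "\<dots> = (\<integral>\<omega>. (X k \<omega> - A \<omega>) * (Y k \<omega> - B \<omega>) + (X k \<omega> - A \<omega>) * B \<omega>
        + A \<omega> * (Y k \<omega> - B \<omega>) \<partial>M)"
      by (rule Bochner_Integration.integral_cong) (auto simp: algebra_simps)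
    also have "\<dots> = (\<integral>\<omega>. (X k \<omega> - A \<omega>) * (Y k \<omega> - B \<omega>) \<partial>M) + (\<integral>\<omega>. (X k \<omega> - A \<omega>) * B \<omega> \<partial>M)
        + (\<integral>\<omega>. A \<omega> * (Y k \<omega> - B \<omega>) \<partial>M)"
      using integrable_times[OF XA YB] integrable_times[OF XA sq(4)] integrable_times[OF sq(3) YB]
      by simp
    finally show ?case
      using Cauchy_Schwarz_integral[OF XA YB] Cauchy_Schwarz_integral[OF XA sq(4)]
        Cauchy_Schwarz_integral[OF sq(3) YB]
      unfolding x_y_def a_b_def real_norm_def by linarith
  qed
  then have "((\<lambda>k. (\<integral>\<omega>. X k \<omega> * Y k \<omega> \<partial>M) - (\<integral>\<omega>. A \<omega> * B \<omega> \<partial>M)) \<longlongrightarrow> 0) F"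
    by (rule Lim_null_comparison) (rule lim)
  then show ?thesis by (simp add: LIM_zero_iff)
qed

text \<open>The Riesz-Fischer argument: on a probability space an \<open>L2\<close> Cauchy sequence
  is Cauchy in \<open>L1\<close>, so a subsequence converges almost everywhere, and Fatou's lemma
  shows that its limit is also the mean square limit of the whole sequence.\<close>

lemma (in prob_space) L2_complete:
  fixes X :: "nat \<Rightarrow> 'a \<Rightarrow> real"
  assumes X: "\<And>k. square_integrable M (X k)"
    and cauchy: "\<And>e. e > 0 \<Longrightarrow> \<exists>N. \<forall>i\<ge>N. \<forall>j\<ge>N. (\<integral>\<omega>. (X i \<omega> - X j \<omega>)\<^sup>2 \<partial>M) < e"
  obtains A where "square_integrable M A" "(\<lambda>k. \<integral>\<omega>. (X k \<omega> - A \<omega>)\<^sup>2 \<partial>M) \<longlonglongrightarrow> 0"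
proof -
  have meas[measurable]: "X k \<in> borel_measurable M" for k
    using X by (simp add: square_integrable_def)
  have int: "integrable M (X k)" for k
    using X square_integrable_imp_integrable[of "X k"] by (simp add: square_integrable_def)
  have L1: "(\<integral>\<omega>. \<bar>X i \<omega> - X j \<omega>\<bar> \<partial>M) \<le> sqrt (\<integral>\<omega>. (X i \<omega> - X j \<omega>)\<^sup>2 \<partial>M)" for i j
  proof -
    have "square_integrable M (\<lambda>\<omega>. \<bar>X i \<omega> - X j \<omega>\<bar>)"
      using square_integrable_diff[OF X X, of i j] by (auto simp: square_integrable_def)
    from Cauchy_Schwarz_integral[OF this square_integrable_const[of 1]] show ?thesis
      by (simp add: prob_space)
  qed
  have "\<exists>N. \<forall>i\<ge>N. \<forall>j\<ge>N. (\<integral>\<omega>. norm (X i \<omega> - X j \<omega>) \<partial>M) < e" if "e > 0" for e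
  proof -
    from that obtain N where "\<forall>i\<ge>N. \<forall>j\<ge>N. (\<integral>\<omega>. (X i \<omega> - X j \<omega>)\<^sup>2 \<partial>M) < e\<^sup>2"
      using cauchy[of "e\<^sup>2"] by auto
    moreover have "sqrt d < e" if "d < e\<^sup>2" for d
      using real_sqrt_less_mono[OF that] \<open>e > 0\<close> by simp
    ultimately have "(\<integral>\<omega>. norm (X i \<omega> - X j \<omega>) \<partial>M) < e" if "i \<ge> N" "j \<ge> N" for i j
      using le_less_trans[OF L1] that unfolding real_norm_def by blast
    then show ?thesis by blast
  qed
  then obtain r where r: "strict_mono r" "AE \<omega> in M. Cauchy (\<lambda>i. X (r i) \<omega>)"
    using cauchy_L1_AE_cauchy_subseq[of M X] int by blast
  define A where "A \<omega> = lim (\<lambda>i. X (r i) \<omega>)" for \<omega>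
  have A[measurable]: "A \<in> borel_measurable M"
    unfolding A_def by measurable
  have conv: "AE \<omega> in M. (\<lambda>i. X (r i) \<omega>) \<longlonglongrightarrow> A \<omega>"
    using r(2) by eventually_elim (simp add: A_def Cauchy_convergent_iff convergent_LIMSEQ_iff)
  \<comment> \<open>Fatou's lemma along the subsequence with \<open>k\<close> fixed. It yields
    integrability together with the bound, but only a weak inequality, whence \<open>e / 2\<close>
    below.\<close>
  have bound: "integrable M (\<lambda>\<omega>. (X k \<omega> - A \<omega>)\<^sup>2) \<and> (\<integral>\<omega>. (X k \<omega> - A \<omega>)\<^sup>2 \<partial>M) \<le> e"
    if e: "e > 0" and N: "\<forall>i\<ge>N. \<forall>j\<ge>N. (\<integral>\<omega>. (X i \<omega> - X j \<omega>)\<^sup>2 \<partial>M) < e" and k: "k \<ge> N" for e N k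
  proof -
    have "(\<integral>\<^sup>+\<omega>. ennreal ((X k \<omega> - A \<omega>)\<^sup>2) \<partial>M)
        = (\<integral>\<^sup>+\<omega>. liminf (\<lambda>i. ennreal ((X k \<omega> - X (r i) \<omega>)\<^sup>2)) \<partial>M)"
    proof (rule nn_integral_cong_AE)
      show "AE \<omega> in M. ennreal ((X k \<omega> - A \<omega>)\<^sup>2) = liminf (\<lambda>i. ennreal ((X k \<omega> - X (r i) \<omega>)\<^sup>2))"
        using conv
      proof eventually_elim
        case (elim \<omega>)
        then have "(\<lambda>i. ennreal ((X k \<omega> - X (r i) \<omega>)\<^sup>2)) \<longlonglongrightarrow> ennreal ((X k \<omega> - A \<omega>)\<^sup>2)"
          by (intro tendsto_intros) auto
        from lim_imp_Liminf[OF trivial_limit_sequentially this] show ?case by (rule sym)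
      qed
    qed
    also have "\<dots> \<le> liminf (\<lambda>i. \<integral>\<^sup>+\<omega>. ennreal ((X k \<omega> - X (r i) \<omega>)\<^sup>2) \<partial>M)"
      by (rule nn_integral_liminf) measurable
    also have "\<dots> \<le> liminf (\<lambda>i. ennreal e)"
    proof (rule Liminf_mono, rule eventually_sequentiallyI[of N])
      fix i assume "N \<le> i"
      then have "r i \<ge> N" using seq_suble[OF r(1), of i] by simp
      then have "(\<integral>\<omega>. (X k \<omega> - X (r i) \<omega>)\<^sup>2 \<partial>M) \<le> e" using N k by (simp add: less_imp_le)
      then show "(\<integral>\<^sup>+\<omega>. ennreal ((X k \<omega> - X (r i) \<omega>)\<^sup>2) \<partial>M) \<le> ennreal e"
        using integrable_power2[OF square_integrable_diff[OF X X]]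
        by (subst nn_integral_eq_integral) (auto intro: ennreal_leI)
    qed
    also have "\<dots> = ennreal e" by (simp add: Liminf_const)
    finally have le: "(\<integral>\<^sup>+\<omega>. ennreal ((X k \<omega> - A \<omega>)\<^sup>2) \<partial>M) \<le> ennreal e" .
    then have i: "integrable M (\<lambda>\<omega>. (X k \<omega> - A \<omega>)\<^sup>2)"
      by (intro integrableI_nonneg) (auto intro: le_less_trans)
    then show ?thesis
      using le e by (simp add: nn_integral_eq_integral)
  qed
  \<comment> \<open>Any fixed bound will do here: \<open>A\<close> is the difference of
    \<open>X N\<close> and \<open>X N - A\<close>, both square integrable.\<close>
  obtain N where N: "\<forall>i\<ge>N. \<forall>j\<ge>N. (\<integral>\<omega>. (X i \<omega> - X j \<omega>)\<^sup>2 \<partial>M) < 1"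
    using cauchy[of 1] by auto
  have "square_integrable M (\<lambda>\<omega>. X N \<omega> - A \<omega>)"
    using bound[OF _ N, of N] by (simp add: square_integrable_def)
  from square_integrable_diff[OF X this, of N] have sqA: "square_integrable M A" by simp
  have "(\<lambda>k. \<integral>\<omega>. (X k \<omega> - A \<omega>)\<^sup>2 \<partial>M) \<longlonglongrightarrow> 0"
  proof (rule LIMSEQ_I)
    fix e :: real assume "e > 0"
    then obtain N where N: "\<forall>i\<ge>N. \<forall>j\<ge>N. (\<integral>\<omega>. (X i \<omega> - X j \<omega>)\<^sup>2 \<partial>M) < e / 2"
      using cauchy[of "e / 2"] by auto
    have "norm ((\<integral>\<omega>. (X k \<omega> - A \<omega>)\<^sup>2 \<partial>M) - 0) < e" if "k \<ge> N" for k
    proof -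
      have "(\<integral>\<omega>. (X k \<omega> - A \<omega>)\<^sup>2 \<partial>M) \<le> e / 2"
        using bound[OF _ N that] \<open>e > 0\<close> by simp
      moreover have "0 \<le> (\<integral>\<omega>. (X k \<omega> - A \<omega>)\<^sup>2 \<partial>M)" by simp
      ultimately show ?thesis using \<open>e > 0\<close> unfolding real_norm_def by linarith
    qed
    then show "\<exists>N. \<forall>k\<ge>N. norm ((\<integral>\<omega>. (X k \<omega> - A \<omega>)\<^sup>2 \<partial>M) - 0) < e" by blast
  qed
  with sqA show thesis by (rule that)
qed

section \<open>Equidistant grids on the circle\<close>

text \<open>Multiplication by \<open>2 * sin (h / 2)\<close> makes the sum telescope, and over
  \<open>N\<close> points the argument advances by \<open>m\<close> full turns, so the two ends
  agree. The condition \<open>0 < m < N\<close> puts \<open>h / 2\<close> strictly between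
  \<open>0\<close> and \<open>pi\<close>, where the factor is nonzero.\<close>

lemma sum_cos_grid_eq_0:
  assumes "0 < m" "m < N"
  shows "(\<Sum>k<N. cos (real m * (2 * pi * real k / real N) + c)) = 0"
proof -
  define h where "h = 2 * pi * real m / real N"
  have arg: "real m * (2 * pi * real k / real N) = real k * h" for k
    by (simp add: h_def)
  have tele: "2 * sin (h / 2) * (\<Sum>k<n. cos (real k * h + c))
      = sin (real n * h - h / 2 + c) - sin (c - h / 2)" for n
  proof (induction n)
    case (Suc n)
    have "2 * sin (h / 2) * cos (real n * h + c)
        = sin (real n * h + h / 2 + c) - sin (real n * h - h / 2 + c)"
      using sin_add[of "real n * h + c" "h / 2"] sin_diff[of "real n * h + c" "h / 2"]
      by (simp add: algebra_simps)
    moreover have "real n * h + h / 2 + c = real (Suc n) * h - h / 2 + c"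
      by (simp add: algebra_simps)
    ultimately show ?case using Suc by (simp add: distrib_left)
  qed simp
  have "real N * h - h / 2 + c = (c - h / 2) + real m * (2 * pi)"
    using assms by (simp add: h_def)
  then have "sin (real N * h - h / 2 + c) = sin (c - h / 2)"
    using sin.plus_of_nat[of "c - h / 2" m] by (simp only: of_real_eq_id id_apply)
  moreover have "0 < h / 2" "h / 2 < pi"
    using assms by (auto simp: h_def field_simps)
  then have "sin (h / 2) \<noteq> 0" using sin_gt_zero[of "h / 2"] by simp
  ultimately show ?thesis using tele[of N] unfolding arg by simp
qed

text \<open>Periodicity is only demanded where the grid points force it, since the covariance is
  only known on \<open>{- 2 * pi..2 * pi}\<close>.\<close>
lemma sum_grid_shift:
  fixes g :: "real \<Rightarrow> real"
  assumes per: "\<And>t. t \<in> {0..2 * pi} \<Longrightarrow> g (t - 2 * pi) = g t" and "k \<le> N" "0 < N"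
  shows "(\<Sum>j<N. g (2 * pi * real j / real N - 2 * pi * real k / real N)) = (\<Sum>j<N. g (2 * pi * real j / real N))"
proof -
  let ?x = "\<lambda>j. 2 * pi * real j / real N"
  have "(\<Sum>j<N. g (?x j - ?x k)) = (\<Sum>j<k. g (?x j - ?x k)) + (\<Sum>j=k..<N. g (?x j - ?x k))"
    using sum.atLeastLessThan_concat[of 0 k N "\<lambda>j. g (?x j - ?x k)"] \<open>k \<le> N\<close>
    by (simp add: atLeast0LessThan)
  \<comment> \<open>For \<open>j < k\<close> the differences are negative; one period up they are
    the grid points with indices from \<open>N - k\<close> to \<open>N - 1\<close>.\<close>
  also have "(\<Sum>j<k. g (?x j - ?x k)) = (\<Sum>j<k. g (?x (j + (N - k))))"
  proof (rule sum.cong[OF refl])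
    fix j assume "j \<in> {..<k}"
    then have jk: "j + (N - k) \<le> N" using \<open>k \<le> N\<close> by auto
    have eq: "?x j - ?x k = ?x (j + (N - k)) - 2 * pi"
      using \<open>k \<le> N\<close> \<open>0 < N\<close> by (simp add: field_simps of_nat_diff)
    have "real (j + (N - k)) \<le> real N" using jk by (simp only: of_nat_le_iff)
    then have "?x (j + (N - k)) \<in> {0..2 * pi}" using \<open>0 < N\<close>
      by (auto simp: divide_le_eq simp del: of_nat_add)
    then show "g (?x j - ?x k) = g (?x (j + (N - k)))" unfolding eq by (rule per)
  qed
  also have "\<dots> = (\<Sum>j=N-k..<N. g (?x j))"
    using sum.shift_bounds_nat_ivl[of "\<lambda>j. g (?x j)" 0 "N - k" k] \<open>k \<le> N\<close>
    by (simp add: atLeast0LessThan)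
  also have "(\<Sum>j=k..<N. g (?x j - ?x k)) = (\<Sum>j<N-k. g (?x j))"
    using sum.shift_bounds_nat_ivl[of "\<lambda>j. g (?x j - ?x k)" 0 k "N - k"] \<open>k \<le> N\<close>
    by (simp add: atLeast0LessThan add_divide_distrib distrib_left)
  also have "(\<Sum>j=N-k..<N. g (?x j)) + (\<Sum>j<N-k. g (?x j)) = (\<Sum>j<N. g (?x j))"
    using sum.atLeastLessThan_concat[of 0 "N - k" N "\<lambda>j. g (?x j)"]
    by (simp add: atLeast0LessThan)
  finally show ?thesis .
qed

text \<open>By uniform continuity each cell of length \<open>h\<close> contributes an error of at
  most \<open>h * (e / 2)\<close>; after division by \<open>2 * pi\<close> the total is at most
  \<open>e / 2\<close>.\<close>

lemma Riemann_sums_tendsto_integral: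
  fixes f :: "real \<Rightarrow> real"
  assumes f: "continuous_on {0..2 * pi} f"
  shows "(\<lambda>N. (\<Sum>j<N. f (2 * pi * real j / real N)) / real N) \<longlonglongrightarrow> integral {0..2 * pi} f / (2 * pi)"
proof (rule LIMSEQ_I)
  fix e :: real assume e: "e > 0"
  have "uniformly_continuous_on {0..2 * pi} f"
    using f compact_uniformly_continuous by blast
  with e obtain d where d: "d > 0"
    "\<And>s t. s \<in> {0..2 * pi} \<Longrightarrow> t \<in> {0..2 * pi} \<Longrightarrow> \<bar>s - t\<bar> < d \<Longrightarrow> \<bar>f s - f t\<bar> < e / 2"
    unfolding uniformly_continuous_on_def dist_real_def
    by (metis half_gt_zero)
  obtain N0 :: nat where N0: "2 * pi / d < real N0" using reals_Archimedean2 by blast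
  show "\<exists>N0. \<forall>N\<ge>N0. norm ((\<Sum>j<N. f (2 * pi * real j / real N)) / real N - integral {0..2 * pi} f / (2 * pi)) < e"
  \<comment> \<open>\<open>Suc\<close> excludes the empty grid \<open>N = 0\<close>.\<close>
  proof (intro exI[of _ "Suc N0"] allI impI)
    fix N assume N: "Suc N0 \<le> N"
    then have "0 < N" by simp
    define h where "h = 2 * pi / real N"
    have h: "0 < h" "h < d" "real N * h = 2 * pi"
    proof -
      have "2 * pi / d < real N" using N0 N by linarith
      then show "h < d" using d \<open>0 < N\<close> by (simp add: h_def field_simps)
    qed (use \<open>0 < N\<close> in \<open>auto simp: h_def\<close>)
    have int: "f integrable_on {a..b}" if "0 \<le> a" "b \<le> 2 * pi" for a b
      by (rule integrable_continuous_interval, rule continuous_on_subset[OF f]) (use that in auto)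
    \<comment> \<open>Cell by cell, by induction on the number \<open>m\<close> of cells
      passed.\<close>
    have "\<bar>integral {0..real m * h} f - h * (\<Sum>j<m. f (real j * h))\<bar> \<le> real m * h * (e / 2)"
      if "m \<le> N" for m
      using that
    proof (induction m)
      case (Suc m)
      have b: "real (Suc m) * h \<le> 2 * pi"
        unfolding h(3)[symmetric] using Suc.prems h(1) by (intro mult_right_mono) auto
      let ?I = "{real m * h..real (Suc m) * h}"
      have le: "0 \<le> real m * h" "real m * h \<le> real (Suc m) * h" using h(1) by (auto simp: algebra_simps)
      have "integral {0..real m * h} f + integral ?I f = integral {0..real (Suc m) * h} f"
        using le int b by (intro Henstock_Kurzweil_Integration.integral_combine) auto
      moreover have "\<bar>integral ?I f - h * f (real m * h)\<bar> \<le> h * (e / 2)"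
      proof -
        have "integral ?I f - h * f (real m * h) = integral ?I (\<lambda>t. f t - f (real m * h))"
          using le int b h(1)
          by (subst Henstock_Kurzweil_Integration.integral_diff) (auto simp: algebra_simps)
        also have "norm \<dots> \<le> e / 2 * (real (Suc m) * h - real m * h)"
        proof (rule integral_bound)
          show "continuous_on ?I (\<lambda>t. f t - f (real m * h))"
            by (intro continuous_intros, rule continuous_on_subset[OF f]) (use le b in auto)
          fix t assume t: "t \<in> ?I"
          then have "\<bar>t - real m * h\<bar> < d" using h by (auto simp: algebra_simps)
          then show "norm (f t - f (real m * h)) \<le> e / 2"
            using d(2)[of t "real m * h"] t le b by auto
        qed (rule le)
        also have "\<dots> = h * (e / 2)" by (simp add: algebra_simps)
        finally show ?thesis by simp
      qed
      ultimately have "\<bar>integral {0..real (Suc m) * h} f - (h * (\<Sum>j<m. f (real j * h)) + h * f (real m * h))\<bar>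
          \<le> real m * h * (e / 2) + h * (e / 2)"
        using Suc by linarith
      then show ?case by (simp add: algebra_simps)
    qed simp
    from this[of N] have "\<bar>integral {0..2 * pi} f - h * (\<Sum>j<N. f (real j * h))\<bar> \<le> 2 * pi * (e / 2)"
      by (simp add: h)
    then have "\<bar>(integral {0..2 * pi} f - h * (\<Sum>j<N. f (real j * h))) / (2 * pi)\<bar> \<le> e / 2"
      by (simp add: abs_mult divide_simps mult.commute)
    moreover have "(integral {0..2 * pi} f - h * (\<Sum>j<N. f (real j * h))) / (2 * pi)
        = integral {0..2 * pi} f / (2 * pi) - (\<Sum>j<N. f (2 * pi * real j / real N)) / real N"
      by (simp add: h_def diff_divide_distrib mult_ac)
    ultimately show "norm ((\<Sum>j<N. f (2 * pi * real j / real N)) / real N - integral {0..2 * pi} f / (2 * pi)) < e"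
      using e by (simp add: abs_minus_commute)
  qed
qed

section \<open>Absolutely convergent Fourier series\<close>

text \<open>The free phase covers sines, and integer frequencies admit both the difference and the
  sum of frequencies that arise in a product of cosines.\<close>

inductive trig_poly :: "(real \<Rightarrow> real) \<Rightarrow> bool" where
  cos: "trig_poly (\<lambda>t. A * cos (of_int k * t + c))"
| add: "trig_poly p \<Longrightarrow> trig_poly q \<Longrightarrow> trig_poly (\<lambda>t. p t + q t)"

lemma trig_poly_mult:
  assumes "trig_poly p" "trig_poly q"
  shows "trig_poly (\<lambda>t. p t * q t)"
  using assms(1)
proof induction
  case (cos A k c)
  show ?case using assms(2)
  proof induction
    case (cos B l d)
    have "A * cos (of_int k * t + c) * (B * cos (of_int l * t + d))
        = A * B / 2 * cos (of_int (k - l) * t + (c - d)) + A * B / 2 * cos (of_int (k + l) * t + (c + d))" for t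
    proof -
      have "of_int (k - l) * t + (c - d) = (of_int k * t + c) - (of_int l * t + d)"
        "of_int (k + l) * t + (c + d) = (of_int k * t + c) + (of_int l * t + d)"
        by (auto simp: algebra_simps)
      then show ?thesis by (simp only: cos_add cos_diff) (simp add: algebra_simps)
    qed
    then show ?case by (simp only: trig_poly.intros)
  next
    case (add p q)
    then show ?case by (simp only: distrib_left trig_poly.add)
  qed
next
  case (add p q)
  then show ?case by (simp only: distrib_right trig_poly.add)
qed

text \<open>Connects polynomial approximation on the unit circle with Fourier analysis: a real
  linear functional at \<open>cis t\<close> is a combination of \<open>cos t\<close> and
  \<open>sin t\<close>, the latter being a cosine of phase \<open>- (pi / 2)\<close>.\<close>

lemma trig_poly_cis:
  assumes "real_polynomial_function g"
  shows "trig_poly (\<lambda>t. g (cis t))"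
  using assms
proof induction
  case (linear f)
  have "f (cis t) = f 1 * cos (of_int 1 * t + 0) + f \<i> * cos (of_int 1 * t + - (pi / 2))" for t
  proof -
    have "cis t = cos t *\<^sub>R 1 + sin t *\<^sub>R \<i>" by (simp add: complex_eq_iff)
    then have "f (cis t) = f (cos t *\<^sub>R 1 + sin t *\<^sub>R \<i>)" by (rule arg_cong)
    also have "\<dots> = cos t * f 1 + sin t * f \<i>"
      using linear by (simp only: linear_simps real_scaleR_def)
    finally show ?thesis
      by (simp add: cos_diff mult.commute)
  qed
  then show ?case by (simp only: trig_poly.intros)
next
  case (const c)
  show ?case using trig_poly.cos[of c 0 0] by simp
qed (auto intro: trig_poly.add trig_poly_mult)

lemma continuous_on_trig_poly: "trig_poly p \<Longrightarrow> continuous_on S p"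
  by (induction rule: trig_poly.induct) (auto intro!: continuous_intros)

text \<open>Frequencies of a \<open>trig_poly\<close> may be negative while the hypothesis speaks of
  natural ones; evenness of the cosine moves the sign into the phase.\<close>

lemma trig_poly_orthogonal:
  assumes "trig_poly p"
    and cos: "\<And>n c. ((\<lambda>t. h t * cos (real n * t + c)) has_integral 0) S"
  shows "((\<lambda>t. h t * p t) has_integral 0) S"
  using assms(1)
proof induction
  case (cos A k c)
  obtain n d where "\<And>t. cos (of_int k * t + c) = cos (real n * t + d)"
  proof (cases k rule: int_cases2)
    case (nonneg n)
    then show ?thesis by (intro that[of n c]) simp
  next
    case (nonpos n)
    have "cos (- (real n * t) + c) = cos (real n * t + - c)" for t
      using cos_minus[of "real n * t + - c"] by simp
    with nonpos show ?thesis by (intro that[of n "- c"]) simp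
  qed
  then show ?case
    using has_integral_mult_right[OF assms(2), of A n d] by (simp add: mult_ac)
next
  case (add p q)
  then show ?case using has_integral_add[of _ 0 S _ 0] by (fastforce simp: distrib_left)
qed

section \<open>Continuous periodic functions on the circle and Fourier uniqueness\<close>

lemma Arg2pi_cis_lift:
  assumes "h (2 * pi) = h 0" "t \<in> {0..2 * pi}"
  shows "h (Arg2pi (cis t)) = h t"
proof (cases "t = 2 * pi")
  case True
  then show ?thesis using assms(1) Arg2pi_of_real[of 1] by simp
next
  case False
  then show ?thesis using assms(2) Arg2pi_unique[of 1 t "cis t"] by (simp add: cis_conv_exp)
qed

lemma continuous_on_Arg2pi_lift:
  fixes h :: "real \<Rightarrow> real"
  assumes "continuous_on {0..2 * pi} h" "h (2 * pi) = h 0"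
  shows "continuous_on (sphere 0 1) (\<lambda>z. h (Arg2pi z))"
proof -
  have "closed ((\<lambda>z. h (Arg2pi z)) -` B \<inter> sphere 0 1)" if "closed B" for B
  proof -
    have lift: "h (Arg2pi (cis t)) = h t" if "t \<in> {0..2 * pi}" for t
      by (rule Arg2pi_cis_lift[of h, OF assms(2) that])
    have "(\<lambda>z. h (Arg2pi z)) -` B \<inter> sphere 0 1 = cis ` (h -` B \<inter> {0..2 * pi})"
    proof (intro equalityI subsetI)
      fix z :: complex assume z: "z \<in> (\<lambda>z. h (Arg2pi z)) -` B \<inter> sphere 0 1"
      then have "z = cis (Arg2pi z)"
        using Arg2pi_eq[of z] by (simp add: cis_conv_exp)
      moreover have "Arg2pi z \<in> h -` B \<inter> {0..2 * pi}"
        using z Arg2pi_ge_0[of z] Arg2pi_lt_2pi[of z] by simp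
      ultimately show "z \<in> cis ` (h -` B \<inter> {0..2 * pi})" by (rule image_eqI)
    next
      fix z assume "z \<in> cis ` (h -` B \<inter> {0..2 * pi})"
      then obtain t where "z = cis t" "h t \<in> B" "t \<in> {0..2 * pi}" by auto
      then show "z \<in> (\<lambda>z. h (Arg2pi z)) -` B \<inter> sphere 0 1" using lift[of t] by simp
    qed
    moreover have "compact (h -` B \<inter> {0..2 * pi})"
    proof -
      have "closed (h -` B \<inter> {0..2 * pi})"
        using assms(1) \<open>closed B\<close> by (simp add: continuous_on_closed_vimage)
      from compact_Int_closed[OF compact_Icc this, of 0 "2 * pi"] show ?thesis
        by (simp add: Int_ac)
    qed
    then have "compact (cis ` (h -` B \<inter> {0..2 * pi}))"
      by (intro compact_continuous_image continuous_intros)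
    ultimately show ?thesis by (simp add: compact_imp_closed)
  qed
  then show ?thesis by (simp add: continuous_on_closed_vimage)
qed

text \<open>Stone-Weierstrass gives a trigonometric polynomial \<open>p\<close> uniformly close to
  \<open>h\<close>. As \<open>h\<close> is orthogonal to \<open>p\<close>, the integral of
  \<open>h * h\<close> equals that of \<open>h * (h - p)\<close>, which is arbitrarily
  small.\<close>

lemma Fourier_uniqueness:
  fixes h :: "real \<Rightarrow> real"
  assumes h: "continuous_on {0..2 * pi} h" "h (2 * pi) = h 0"
    and orth: "\<And>n c. ((\<lambda>t. h t * cos (real n * t + c)) has_integral 0) {0..2 * pi}"
    and t: "t \<in> {0..2 * pi}"
  shows "h t = 0"
proof -
  define J where "J = integral {0..2 * pi} (\<lambda>t. h t * h t)"
  obtain B where B: "B > 0" "\<And>t. t \<in> {0..2 * pi} \<Longrightarrow> \<bar>h t\<bar> \<le> B"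
    using compact_imp_bounded[OF compact_continuous_image[OF h(1)]] by (auto simp: bounded_pos)
  have small: "\<bar>J\<bar> \<le> B * e * (2 * pi)" if "e > 0" for e
  proof -
    obtain g where g: "real_polynomial_function g" "\<And>z. z \<in> sphere 0 1 \<Longrightarrow> \<bar>h (Arg2pi z) - g z\<bar> < e"
      using Stone_Weierstrass_real_polynomial_function[OF _ continuous_on_Arg2pi_lift[OF h] \<open>e > 0\<close>]
      by auto
    define p where "p t = g (cis t)" for t
    have p: "trig_poly p" unfolding p_def by (rule trig_poly_cis[OF g(1)])
    have close: "\<bar>h t - p t\<bar> \<le> e" if "t \<in> {0..2 * pi}" for t
      using g(2)[of "cis t"] Arg2pi_cis_lift[of h, OF h(2) that] by (simp add: p_def)
    have cont: "continuous_on {0..2 * pi} (\<lambda>t. h t * (h t - p t))" "continuous_on {0..2 * pi} (\<lambda>t. h t * h t)"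
      by (intro continuous_intros h continuous_on_trig_poly[OF p])+
    have "((\<lambda>t. h t * h t - h t * p t) has_integral J - 0) {0..2 * pi}"
      unfolding J_def
      by (intro has_integral_diff integrable_integral integrable_continuous_interval cont
        trig_poly_orthogonal[OF p orth])
    then have "J = integral {0..2 * pi} (\<lambda>t. h t * (h t - p t))"
      by (simp add: right_diff_distrib integral_unique)
    also have "norm \<dots> \<le> B * e * (2 * pi - 0)"
    proof (rule integral_bound[OF _ cont(1)])
      fix t assume "t \<in> {0..2 * pi}"
      then show "norm (h t * (h t - p t)) \<le> B * e"
        using B close \<open>e > 0\<close> by (simp add: abs_mult mult_mono)
    qed simp
    finally show ?thesis by simp
  qed
  have "J = 0"
  proof (rule ccontr)
    assume "J \<noteq> 0"
    \<comment> \<open>With this \<open>e\<close> the bound becomes half of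
      \<open>\<bar>J\<bar>\<close>.\<close>
    then show False using small[of "\<bar>J\<bar> / (B * (4 * pi))"] B(1) by (simp add: field_simps)
  qed
  then have "\<forall>t\<in>{0..2 * pi}. h t * h t = 0"
    unfolding J_def by (subst (asm) integral_eq_0_iff) (auto intro!: continuous_intros h)
  then show ?thesis using t by simp
qed

section \<open>Fourier coefficients and the sum of the Fourier series\<close>

lemma has_integral_cos_period:
  assumes "k \<noteq> 0"
  shows "((\<lambda>t. cos (of_int k * t + c)) has_integral 0) {0..2 * pi}"
proof -
  have "((\<lambda>t. cos (of_int k * t + c)) has_integral
      sin (of_int k * (2 * pi) + c) / of_int k - sin (of_int k * 0 + c) / of_int k) {0..2 * pi}"
    using assms
    by (intro fundamental_theorem_of_calculus)
      (auto intro!: derivative_eq_intros simp: has_real_derivative_iff_has_vector_derivative[symmetric])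
  moreover have "sin (of_int k * (2 * pi) + c) = sin c"
    using sin.plus_of_int[of c k] by (simp only: of_real_eq_id id_apply add.commute)
  ultimately show ?thesis by simp
qed

text \<open>The product-to-sum formula has the frequencies \<open>n - m\<close> and
  \<open>n + m\<close>. Either both are nonzero, or only the difference vanishes, or both vanish;
  hence three cases.\<close>

lemma has_integral_cos_times_cos:
  "((\<lambda>t. cos (real n * t + a) * cos (real m * t + c)) has_integral
     (if n \<noteq> m then 0 else if n = 0 then 2 * pi * (cos a * cos c) else pi * cos (a - c))) {0..2 * pi}"
proof -
  have eq: "cos (real n * t + a) * cos (real m * t + c) =
      (cos (of_int (int n - int m) * t + (a - c)) + cos (of_int (int n + int m) * t + (a + c))) / 2" for t
  proof -
    have "of_int (int n - int m) * t + (a - c) = (real n * t + a) - (real m * t + c)"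
      "of_int (int n + int m) * t + (a + c) = (real n * t + a) + (real m * t + c)"
      by (auto simp: algebra_simps)
    then show ?thesis by (simp only: cos_times_cos)
  qed
  consider "n \<noteq> m" | "n = m" "n \<noteq> 0" | "n = m" "n = 0" by auto
  then show ?thesis
  proof cases
    case 1
    then have "((\<lambda>t. (cos (of_int (int n - int m) * t + (a - c)) + cos (of_int (int n + int m) * t + (a + c))) / 2)
        has_integral (0 + 0) / 2) {0..2 * pi}"
      by (intro has_integral_divide has_integral_add has_integral_cos_period) auto
    with 1 show ?thesis by (simp only: eq) simp
  next
    case 2
    have "((\<lambda>t. (cos (a - c) + cos (of_int (int n + int m) * t + (a + c))) / 2)
        has_integral ((2 * pi - 0) *\<^sub>R cos (a - c) + 0) / 2) {0..2 * pi}"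
      using 2 has_integral_const_real[of "cos (a - c)" 0 "2 * pi"]
      by (intro has_integral_divide has_integral_add has_integral_cos_period) auto
    with 2 show ?thesis unfolding eq by simp
  next
    case 3
    then show ?thesis using has_integral_const_real[of "cos a * cos c" 0 "2 * pi"] by simp
  qed
qed

text \<open>Phase \<open>0\<close> gives the cosine and phase \<open>- (pi / 2)\<close> the sine
  coefficient, so one notion treats both. It is a mean over the period for every \<open>n\<close>,
  the limit of averages over grids.\<close>

definition fourier_coeff :: "(real \<Rightarrow> real) \<Rightarrow> nat \<Rightarrow> real \<Rightarrow> real" where
  "fourier_coeff f n c = integral {0..2 * pi} (\<lambda>t. f t * cos (real n * t + c)) / (2 * pi)"

lemma fourier_coeff_phase:
  assumes f: "continuous_on {0..2 * pi} f"
  shows "fourier_coeff f n c = cos c * fourier_coeff f n 0 - sin c * fourier_coeff f n (- (pi / 2))"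
proof -
  have i: "(\<lambda>t. f t * cos (real n * t + d)) integrable_on {0..2 * pi}" for d
    by (intro integrable_continuous_interval continuous_intros f)
  have "integral {0..2 * pi} (\<lambda>t. f t * cos (real n * t + c)) = integral {0..2 * pi}
      (\<lambda>t. cos c * (f t * cos (real n * t + 0)) - sin c * (f t * cos (real n * t + - (pi / 2))))"
    by (rule Henstock_Kurzweil_Integration.integral_cong) (simp add: cos_add cos_diff algebra_simps)
  also have "\<dots> = cos c * integral {0..2 * pi} (\<lambda>t. f t * cos (real n * t + 0))
      - sin c * integral {0..2 * pi} (\<lambda>t. f t * cos (real n * t + - (pi / 2)))"
    using i[of 0] i[of "- (pi / 2)"]
    by (subst Henstock_Kurzweil_Integration.integral_diff) (auto intro!: integrable_on_mult_right)
  finally show ?thesis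
    by (simp add: fourier_coeff_def diff_divide_distrib)
qed

text \<open>The inverse of the mean square of \<open>cos (real n * t)\<close> over a period.\<close>

definition fourier_weight :: "nat \<Rightarrow> real" where
  "fourier_weight n = (if n = 0 then 1 else 2)"

text \<open>The series converges uniformly by the Weierstrass test, so its sum \<open>g\<close> is
  continuous and its coefficients may be computed term by term. They agree with those of
  \<open>f\<close>, and \<open>Fourier_uniqueness\<close> applies to the difference.\<close>

lemma Fourier_series_sums:
  fixes f :: "real \<Rightarrow> real"
  assumes f: "continuous_on {0..2 * pi} f" "f (2 * pi) = f 0"
    and sum: "\<And>c. summable (\<lambda>n. \<bar>fourier_coeff f n c\<bar>)"
    and t: "t \<in> {0..2 * pi}"
  shows "(\<lambda>n. fourier_weight n * fourier_coeff f n 0 * cos (real n * t)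
      + fourier_weight n * fourier_coeff f n (- (pi / 2)) * sin (real n * t)) sums f t"
proof -
  define u where "u n t = fourier_weight n * (fourier_coeff f n 0 * cos (real n * t + 0)
    + fourier_coeff f n (- (pi / 2)) * cos (real n * t + - (pi / 2)))" for n t
  define B where "B n = 2 * (\<bar>fourier_coeff f n 0\<bar> + \<bar>fourier_coeff f n (- (pi / 2))\<bar>)" for n
  define g where "g t = (\<Sum>n. u n t)" for t
  have B: "summable B"
    unfolding B_def by (intro summable_mult summable_add sum)
  have bound: "\<bar>u n t\<bar> \<le> B n" for n t
  proof -
    have "\<bar>fourier_coeff f n d * cos x\<bar> \<le> \<bar>fourier_coeff f n d\<bar>" for d x
      by (simp add: abs_mult mult_left_le)
    then have "\<bar>fourier_coeff f n 0 * cos (real n * t + 0)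
        + fourier_coeff f n (- (pi / 2)) * cos (real n * t + - (pi / 2))\<bar>
      \<le> \<bar>fourier_coeff f n 0\<bar> + \<bar>fourier_coeff f n (- (pi / 2))\<bar>"
      by (meson abs_triangle_ineq add_mono order_trans)
    then show ?thesis
      unfolding u_def B_def abs_mult by (intro mult_mono) (auto simp: fourier_weight_def)
  qed
  have cont_u: "continuous_on S (u n)" for n S
    unfolding u_def by (intro continuous_intros)
  have summ: "summable (\<lambda>n. u n t)" for t
    by (rule summable_comparison_test[OF _ B]) (use bound in auto)
  \<comment> \<open>The factor \<open>v\<close> is \<open>1\<close> for the continuity of
    \<open>g\<close> and a cosine for its coefficients.\<close>
  have unif: "uniform_limit UNIV (\<lambda>K t. \<Sum>n<K. u n t * v t) (\<lambda>t. \<Sum>n. u n t * v t) sequentially"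
    if "\<And>t. \<bar>v t\<bar> \<le> 1" for v :: "real \<Rightarrow> real"
  proof (rule Weierstrass_m_test[OF _ B])
    show "norm (u n t * v t) \<le> B n" for n t
      using mult_mono[OF bound that, of n t t] by (auto simp: abs_mult B_def)
  qed
  have cont_g: "continuous_on {0..2 * pi} g"
  proof (rule uniform_limit_theorem)
    show "uniform_limit {0..2 * pi} (\<lambda>K t. \<Sum>n<K. u n t) g sequentially"
      using uniform_limit_on_subset[OF unif[of "\<lambda>_. 1"]] by (simp add: g_def[abs_def])
  qed (auto intro!: always_eventually continuous_on_sum cont_u)
  have coeff_g: "((\<lambda>t. g t * cos (real m * t + c)) has_integral 2 * pi * fourier_coeff f m c) {0..2 * pi}" for m c
  proof -
    let ?v = "\<lambda>t. cos (real m * t + c)"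
    have termwise: "((\<lambda>t. u n t * ?v t) has_integral (if n = m then 2 * pi * fourier_coeff f m c else 0)) {0..2 * pi}" for n
    proof -
      let ?I = "\<lambda>a. if n \<noteq> m then 0 else if n = 0 then 2 * pi * (cos a * cos c) else pi * cos (a - c)"
      have "((\<lambda>t. fourier_weight n * (fourier_coeff f n 0 * (cos (real n * t + 0) * ?v t)
          + fourier_coeff f n (- (pi / 2)) * (cos (real n * t + - (pi / 2)) * ?v t))) has_integral
          fourier_weight n * (fourier_coeff f n 0 * ?I 0 + fourier_coeff f n (- (pi / 2)) * ?I (- (pi / 2)))) {0..2 * pi}"
        by (intro has_integral_mult_right has_integral_add has_integral_cos_times_cos)
      moreover have "fourier_weight n * (fourier_coeff f n 0 * ?I 0 + fourier_coeff f n (- (pi / 2)) * ?I (- (pi / 2)))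
          = (if n = m then 2 * pi * fourier_coeff f m c else 0)"
      proof -
        have "cos (- (pi / 2) - c) = - sin c" by (simp add: cos_diff)
        moreover have "fourier_coeff f 0 (- (pi / 2)) = 0" by (simp add: fourier_coeff_def)
        ultimately show ?thesis
          by (auto simp: fourier_coeff_phase[OF f(1), of m c] fourier_weight_def algebra_simps)
      qed
      moreover have "(\<lambda>t. fourier_weight n * (fourier_coeff f n 0 * (cos (real n * t + 0) * ?v t)
          + fourier_coeff f n (- (pi / 2)) * (cos (real n * t + - (pi / 2)) * ?v t))) = (\<lambda>t. u n t * ?v t)"
        by (simp add: u_def algebra_simps fun_eq_iff)
      ultimately show ?thesis by (simp only:)
    qed
    have "(\<lambda>t. \<Sum>n. u n t * ?v t) = (\<lambda>t. g t * ?v t)"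
      by (simp add: g_def suminf_mult2[OF summ])
    moreover have "uniform_limit {0..2 * pi} (\<lambda>K t. \<Sum>n<K. u n t * ?v t) (\<lambda>t. \<Sum>n. u n t * ?v t) sequentially"
      by (rule uniform_limit_on_subset[OF unif]) auto
    ultimately have unif_v: "uniform_limit {0..2 * pi} (\<lambda>K t. \<Sum>n<K. u n t * ?v t) (\<lambda>t. g t * ?v t) sequentially"
      by (simp only:)
    have cont_v: "continuous_on {0..2 * pi} (\<lambda>t. \<Sum>n<K. u n t * ?v t)" for K
      by (intro continuous_intros cont_u)
    obtain I J where IJ: "\<And>K. ((\<lambda>t. \<Sum>n<K. u n t * ?v t) has_integral I K) {0..2 * pi}"
      "((\<lambda>t. g t * ?v t) has_integral J) {0..2 * pi}" "I \<longlonglongrightarrow> J"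
      using uniform_limit_integral[OF unif_v cont_v sequentially_bot] by blast
    have "I K = (\<Sum>n<K. if n = m then 2 * pi * fourier_coeff f m c else 0)" for K
      by (rule has_integral_unique[OF IJ(1)]) (rule has_integral_sum[OF finite_lessThan termwise])
    \<comment> \<open>By orthogonality only the term \<open>n = m\<close> survives, and it is
      present from \<open>K = Suc m\<close> on.\<close>
    then have "eventually (\<lambda>K. I K = 2 * pi * fourier_coeff f m c) sequentially"
      by (intro eventually_sequentiallyI[of "Suc m"]) simp
    then have "I \<longlonglongrightarrow> 2 * pi * fourier_coeff f m c" by (rule tendsto_eventually)
    with IJ(2,3) show ?thesis using LIMSEQ_unique by blast
  qed
  have "f t - g t = 0"
  proof (rule Fourier_uniqueness[OF _ _ _ t])
    show "continuous_on {0..2 * pi} (\<lambda>t. f t - g t)"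
      by (intro continuous_intros f cont_g)
    have "u n (2 * pi) = u n 0" for n
      using cos.plus_of_nat[of "0::real" n] cos.plus_of_nat[of "- (pi / 2)" n]
      by (simp add: u_def)
    then show "f (2 * pi) - g (2 * pi) = f 0 - g 0"
      using f(2) by (simp add: g_def)
    fix n c
    have "((\<lambda>t. f t * cos (real n * t + c)) has_integral 2 * pi * fourier_coeff f n c) {0..2 * pi}"
      unfolding fourier_coeff_def
      by simp (intro integrable_integral integrable_continuous_interval continuous_intros f)
    from has_integral_diff[OF this coeff_g[of n c]]
    show "((\<lambda>t. (f t - g t) * cos (real n * t + c)) has_integral 0) {0..2 * pi}"
      by (simp add: left_diff_distrib)
  qed
  then have "(\<lambda>n. u n t) sums f t"
    using summable_sums[OF summ[of t]] by (simp add: g_def)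
  then show ?thesis
    by (simp add: u_def cos_diff algebra_simps)
qed

section \<open>Stationary fields on the circle\<close>

text \<open>In the application the index is the latitude and the real argument the longitude on that
  parallel. The fields are centred, so mixed moments are covariances.\<close>

locale circle_fields = prob_space M for M :: "'w measure" +
  fixes I :: "'i set" and Y :: "'i \<Rightarrow> real \<Rightarrow> 'w \<Rightarrow> real" and C :: "'i \<Rightarrow> 'i \<Rightarrow> real \<Rightarrow> real"
  assumes sq: "i \<in> I \<Longrightarrow> t \<in> {0..2 * pi} \<Longrightarrow> square_integrable M (Y i t)"
    and mean: "i \<in> I \<Longrightarrow> t \<in> {0..2 * pi} \<Longrightarrow> (\<integral>\<omega>. Y i t \<omega> \<partial>M) = 0"
    and cov: "i \<in> I \<Longrightarrow> j \<in> I \<Longrightarrow> s \<in> {0..2 * pi} \<Longrightarrow> t \<in> {0..2 * pi} \<Longrightarrow>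
      (\<integral>\<omega>. Y i s \<omega> * Y j t \<omega> \<partial>M) = C i j (s - t)"
    and periodic: "i \<in> I \<Longrightarrow> Y i (2 * pi) = Y i 0"
    and cont: "i \<in> I \<Longrightarrow> j \<in> I \<Longrightarrow> continuous_on {0..2 * pi} (C i j)"
begin

text \<open>Write both sides as moments with the same first factor at \<open>t\<close>; the second
  factors, at \<open>2 * pi\<close> and at \<open>0\<close>, coincide.\<close>

lemma C_periodic:
  assumes "i \<in> I" "j \<in> I" "t \<in> {0..2 * pi}"
  shows "C i j (t - 2 * pi) = C i j t"
  using cov[OF assms, of "2 * pi"] cov[OF assms, of 0] periodic[of j] assms by simp

definition grid :: "nat \<Rightarrow> nat \<Rightarrow> real" where
  "grid N k = 2 * pi * real k / real N"

lemma grid_in: "k \<le> N \<Longrightarrow> grid N k \<in> {0..2 * pi}"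
  by (cases "N = 0") (auto simp: grid_def divide_le_eq)

text \<open>
  Riemann sums of the Fourier coefficients of the paths of \<open>Y\<close> (\<open>field_coeff\<close>) and of \<open>C\<close>
  (\<open>cov_coeff\<close>). On nested grids the moments of the former are exactly given by the latter, up to
  the term \<open>alias_coeff\<close>, which vanishes as soon as the grid resolves the frequency \<open>2 * n\<close>.
\<close>
definition field_coeff :: "nat \<Rightarrow> real \<Rightarrow> nat \<Rightarrow> 'i \<Rightarrow> 'w \<Rightarrow> real" where
  "field_coeff n c N i \<omega> = (\<Sum>k<N. cos (real n * grid N k + c) / real N * Y i (grid N k) \<omega>)"

definition cov_coeff :: "nat \<Rightarrow> real \<Rightarrow> nat \<Rightarrow> 'i \<Rightarrow> 'i \<Rightarrow> real" where
  "cov_coeff n c N i j = (\<Sum>k<N. C i j (grid N k) * cos (real n * grid N k + c)) / real N"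

definition alias_coeff :: "nat \<Rightarrow> real \<Rightarrow> nat \<Rightarrow> nat \<Rightarrow> 'i \<Rightarrow> 'i \<Rightarrow> real" where
  "alias_coeff n c N L i j = (\<Sum>l<L. C i j (grid L l) *
     (\<Sum>k<N. cos (real (2 * n) * grid N k + (real n * grid L l + c)))) / (real N * real L)"

lemma square_integrable_field_coeff: "i \<in> I \<Longrightarrow> square_integrable M (field_coeff n c N i)"
  unfolding field_coeff_def[abs_def]
  by (intro square_integrable_sum square_integrable_cmult sq grid_in) auto

lemma mean_field_coeff:
  assumes "i \<in> I"
  shows "(\<integral>\<omega>. field_coeff n c N i \<omega> \<partial>M) = 0"
proof -
  have "integrable M (Y i (grid N k))" "(\<integral>\<omega>. Y i (grid N k) \<omega> \<partial>M) = 0" if "k < N" for k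
  proof -
    have k: "grid N k \<in> {0..2 * pi}" using that by (intro grid_in) simp
    show "integrable M (Y i (grid N k))"
      by (rule square_integrable_imp_integrable)
        (use sq[OF assms k] in \<open>simp_all only: square_integrable_def\<close>)
    show "(\<integral>\<omega>. Y i (grid N k) \<omega> \<partial>M) = 0" by (rule mean[OF assms k])
  qed
  then show ?thesis
    unfolding field_coeff_def by (subst Bochner_Integration.integral_sum) simp_all
qed

section \<open>Second moments of the Riemann sums\<close>

text \<open>Since \<open>N\<close> divides \<open>L\<close>, the point \<open>grid N k\<close>
  belongs to the finer grid, and a cyclic shift moves it from the argument of \<open>C\<close> into
  the phase of the cosine.\<close>

lemma C_grid_shift:
  assumes ij: "i \<in> I" "j \<in> I" and "0 < L" "N dvd L" "k \<le> N"
  shows "(\<Sum>l<L. cos (real n * grid L l + c) * C i j (grid L l - grid N k)) =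
    (\<Sum>l<L. C i j (grid L l) * cos (real n * grid L l + (real n * grid N k + c)))"
proof -
  from \<open>N dvd L\<close> obtain q where q: "L = N * q" by auto
  have "0 < N" "0 < q" using \<open>0 < L\<close> q by auto
  then have gk: "grid N k = 2 * pi * real (k * q) / real L"
    by (simp add: grid_def q)
  define g where "g t = C i j t * cos (real n * t + (real n * grid N k + c))" for t
  have "(\<Sum>l<L. cos (real n * grid L l + c) * C i j (grid L l - grid N k)) = (\<Sum>l<L. g (grid L l - grid N k))"
    by (simp add: g_def algebra_simps)
  also have "\<dots> = (\<Sum>l<L. g (grid L l))"
    unfolding gk unfolding grid_def
  proof (rule sum_grid_shift)
    fix t assume t: "t \<in> {0..2 * pi}"
    have "cos (real n * (t - 2 * pi) + (real n * grid N k + c)) = cos (real n * t + (real n * grid N k + c))"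
      using cos.minus_of_nat[of "real n * t + (real n * grid N k + c)" n]
      by (simp add: algebra_simps)
    then show "g (t - 2 * pi) = g t" using C_periodic[OF ij t] by (simp add: g_def)
  qed (use assms q in auto)
  finally show ?thesis by (simp add: g_def)
qed

text \<open>After the shift, \<open>C\<close> depends on \<open>l\<close> alone. The product of the
  two remaining cosines splits into a part free of \<open>k\<close>, which gives
  \<open>cov_coeff\<close>, and a part of frequency \<open>2 * n\<close> in \<open>k\<close>, the
  aliasing term.\<close>

lemma integral_field_coeff_times:
  assumes ij: "i \<in> I" "j \<in> I" and "0 < L" "N dvd L"
  shows "(\<integral>\<omega>. field_coeff n c L i \<omega> * field_coeff n d N j \<omega> \<partial>M) = (cov_coeff n (c - d) L i j + alias_coeff n (c + d) N L i j) / 2"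
proof -
  have "0 < N" using assms by (auto intro: Nat.gr0I)
  have "(\<integral>\<omega>. field_coeff n c L i \<omega> * field_coeff n d N j \<omega> \<partial>M) =
    (\<Sum>l<L. \<Sum>k<N. cos (real n * grid L l + c) / real L * (cos (real n * grid N k + d) / real N) *
      C i j (grid L l - grid N k))"
    unfolding field_coeff_def
    by (subst integral_times_sum) (auto intro!: sq ij grid_in sum.cong simp: cov[OF ij grid_in grid_in])
  also have "\<dots> = (\<Sum>k<N. cos (real n * grid N k + d) *
      (\<Sum>l<L. cos (real n * grid L l + c) * C i j (grid L l - grid N k))) / (real N * real L)"
    by (subst sum.swap) (simp add: sum_distrib_left sum_divide_distrib mult_ac)
  also have "\<dots> = (\<Sum>k<N. cos (real n * grid N k + d) *
      (\<Sum>l<L. C i j (grid L l) * cos (real n * grid L l + (real n * grid N k + c)))) / (real N * real L)"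
    using C_grid_shift[OF ij \<open>0 < L\<close> \<open>N dvd L\<close>] by simp
  also have "\<dots> = (\<Sum>l<L. C i j (grid L l) * (\<Sum>k<N.
      cos (real n * grid L l + (real n * grid N k + c)) * cos (real n * grid N k + d))) / (real N * real L)"
    unfolding sum_distrib_left by (subst sum.swap) (simp add: mult_ac)
  also have "\<dots> = (\<Sum>l<L. C i j (grid L l) * (\<Sum>k<N. (cos (real n * grid L l + (c - d))
      + cos (real (2 * n) * grid N k + (real n * grid L l + (c + d)))) / 2)) / (real N * real L)"
    unfolding cos_times_cos by (simp add: algebra_simps)
  also have "\<dots> = (cov_coeff n (c - d) L i j + alias_coeff n (c + d) N L i j) / 2"
    using \<open>0 < N\<close>
    by (simp add: cov_coeff_def alias_coeff_def sum.distrib sum_divide_distrib[symmetric] distrib_left add_divide_distrib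
        sum_distrib_left[symmetric] mult.left_commute[of _ "real N"])
  finally show ?thesis .
qed

lemma alias_coeff_eq_0: "0 < n \<Longrightarrow> 2 * n < N \<Longrightarrow> alias_coeff n c N L i j = 0"
  unfolding alias_coeff_def grid_def by (subst sum_cos_grid_eq_0) auto

text \<open>For \<open>n = 0\<close> the aliasing term equals \<open>cov_coeff\<close>, for
  \<open>n > 0\<close> it vanishes; \<open>fourier_weight\<close> unites the two cases. The coarser
  grid does not enter the value.\<close>

lemma integral_field_coeff_times_phase_0:
  assumes ij: "i \<in> I" "j \<in> I" and "0 < L" "N dvd L" "2 * n < N"
  shows "(\<integral>\<omega>. field_coeff n 0 L i \<omega> * field_coeff n 0 N j \<omega> \<partial>M) = cov_coeff n 0 L i j / fourier_weight n"
proof (cases "n = 0")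
  case True
  then have "alias_coeff n 0 N L i j = cov_coeff n 0 L i j"
    using assms by (simp add: alias_coeff_def cov_coeff_def sum_distrib_right[symmetric])
  then show ?thesis
    using integral_field_coeff_times[OF ij \<open>0 < L\<close> \<open>N dvd L\<close>, of n 0 0] True by (simp add: fourier_weight_def)
next
  case False
  then show ?thesis
    using integral_field_coeff_times[OF ij \<open>0 < L\<close> \<open>N dvd L\<close>, of n 0 0] alias_coeff_eq_0 \<open>2 * n < N\<close>
    by (simp add: fourier_weight_def)
qed

section \<open>Positivity and absolute summability of the coefficients\<close>

text \<open>The phases \<open>0\<close> and \<open>- pi / 2\<close> give opposite aliasing terms, so \<open>cov_coeff\<close> is a sum of two second moments.\<close>
lemma cov_coeff_nonneg:
  assumes "i \<in> I" "0 < N"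
  shows "0 \<le> cov_coeff n 0 N i i"
proof -
  have "cos (real (2 * n) * grid N k + (real n * grid N l + - pi)) =
      - cos (real (2 * n) * grid N k + (real n * grid N l + 0))" for k l
    using cos_minus_pi[of "real (2 * n) * grid N k + real n * grid N l"] by (simp add: algebra_simps)
  then have "alias_coeff n (- pi) N N i i = - alias_coeff n 0 N N i i"
    by (simp add: alias_coeff_def sum_negf)
  moreover have "- (pi / 2) + - (pi / 2) = - pi" by simp
  ultimately have "(\<integral>\<omega>. field_coeff n 0 N i \<omega> * field_coeff n 0 N i \<omega> \<partial>M)
      + (\<integral>\<omega>. field_coeff n (- (pi / 2)) N i \<omega> * field_coeff n (- (pi / 2)) N i \<omega> \<partial>M) = cov_coeff n 0 N i i"
    using integral_field_coeff_times[OF assms(1,1,2) dvd_refl, of n 0 0]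
      integral_field_coeff_times[OF assms(1,1,2) dvd_refl, of n "- (pi / 2)" "- (pi / 2)"]
    by simp
  moreover have "0 \<le> (\<integral>\<omega>. field_coeff n c N i \<omega> * field_coeff n c N i \<omega> \<partial>M)" for c
    by (rule Bochner_Integration.integral_nonneg) simp
  ultimately show ?thesis by (metis add_nonneg_nonneg)
qed

text \<open>Without aliasing a moment depends on the difference of the phases only. Phase
  \<open>c\<close> is given to the field \<open>i\<close> and \<open>0\<close> to the field
  \<open>j\<close>; in the two variances the phases cancel.\<close>

lemma abs_cov_coeff_le:
  assumes ij: "i \<in> I" "j \<in> I" and n: "0 < n" "2 * n < N"
  shows "\<bar>cov_coeff n c N i j\<bar> \<le> (cov_coeff n 0 N i i + cov_coeff n 0 N j j) / 2"
proof -
  have "0 < N" using n by simp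
  have key: "(\<integral>\<omega>. field_coeff n d N k \<omega> * field_coeff n e N l \<omega> \<partial>M) = cov_coeff n (d - e) N k l / 2"
    if "k \<in> I" "l \<in> I" for k l d e
    using integral_field_coeff_times[OF that \<open>0 < N\<close> dvd_refl, of n d e]
    unfolding alias_coeff_eq_0[OF n] by simp
  have "2 * \<bar>cov_coeff n (c - 0) N i j / 2\<bar> \<le> cov_coeff n (c - c) N i i / 2 + cov_coeff n (0 - 0) N j j / 2"
    using two_abs_integral_times_le[OF square_integrable_field_coeff[OF ij(1), of n c N] square_integrable_field_coeff[OF ij(2), of n 0 N]]
    unfolding key[OF ij] key[OF ij(1) ij(1)] key[OF ij(2) ij(2)] .
  then show ?thesis by simp
qed

text \<open>Discrete Fourier inversion at \<open>0\<close>: frequency and grid index play symmetric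
  roles in \<open>cos (real n * grid N k)\<close>, so the sum over all \<open>N\<close> frequencies
  vanishes except at \<open>k = 0\<close>.\<close>

lemma sum_cov_coeff_eq:
  assumes "0 < N"
  shows "(\<Sum>n<N. cov_coeff n 0 N i j) = C i j 0"
proof -
  have "(\<Sum>n<N. cov_coeff n 0 N i j) = (\<Sum>k<N. C i j (grid N k) * (\<Sum>n<N. cos (real n * grid N k))) / real N"
    unfolding cov_coeff_def sum_divide_distrib[symmetric] sum_distrib_left by (subst sum.swap) simp
  also have "(\<Sum>k<N. C i j (grid N k) * (\<Sum>n<N. cos (real n * grid N k))) =
      (\<Sum>k<N. if k = 0 then C i j 0 * real N else 0)"
  proof (rule sum.cong[OF refl])
    fix k assume "k \<in> {..<N}"
    then show "C i j (grid N k) * (\<Sum>n<N. cos (real n * grid N k)) = (if k = 0 then C i j 0 * real N else 0)"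
      using sum_cos_grid_eq_0[of k N 0] by (auto simp: grid_def mult_ac)
  qed
  finally show ?thesis using assms by simp
qed

lemma cov_coeff_tendsto:
  assumes "i \<in> I" "j \<in> I"
  shows "(\<lambda>N. cov_coeff n c N i j) \<longlonglongrightarrow> fourier_coeff (C i j) n c"
  unfolding cov_coeff_def grid_def fourier_coeff_def
  by (rule Riemann_sums_tendsto_integral) (intro continuous_intros cont assms)

lemma fourier_coeff_nonneg: "i \<in> I \<Longrightarrow> 0 \<le> fourier_coeff (C i i) n 0"
  by (rule LIMSEQ_le_const[OF cov_coeff_tendsto]) (auto intro!: exI[of _ 1] cov_coeff_nonneg)

text \<open>On every grid with more than \<open>K\<close> points the first \<open>K\<close>
  coefficients are part of a nonnegative sum equal to \<open>C i i 0\<close>; this bound survives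
  the limit in \<open>N\<close>.\<close>

lemma summable_fourier_coeff_diag:
  assumes "i \<in> I"
  shows "summable (\<lambda>n. fourier_coeff (C i i) n 0)"
proof (rule summableI_nonneg_bounded)
  fix K
  have "(\<lambda>N. \<Sum>n<K. cov_coeff n 0 N i i) \<longlonglongrightarrow> (\<Sum>n<K. fourier_coeff (C i i) n 0)"
    by (intro tendsto_sum cov_coeff_tendsto assms)
  moreover have "(\<Sum>n<K. cov_coeff n 0 N i i) \<le> C i i 0" if "Suc K \<le> N" for N
  proof -
    have "(\<Sum>n<K. cov_coeff n 0 N i i) \<le> (\<Sum>n<N. cov_coeff n 0 N i i)"
      using that by (intro sum_mono2) (auto intro!: cov_coeff_nonneg assms)
    then show ?thesis using that sum_cov_coeff_eq by simp
  qed
  ultimately show "(\<Sum>n<K. fourier_coeff (C i i) n 0) \<le> C i i 0"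
    by (intro LIMSEQ_le_const2) auto
qed (rule fourier_coeff_nonneg[OF assms])

text \<open>The grid bound passes to the limit for \<open>n \<ge> 1\<close>, where aliasing
  eventually disappears; a single term does not affect summability.\<close>

lemma summable_abs_fourier_coeff:
  assumes ij: "i \<in> I" "j \<in> I"
  shows "summable (\<lambda>n. \<bar>fourier_coeff (C i j) n c\<bar>)"
proof (rule summable_comparison_test)
  show "summable (\<lambda>n. (fourier_coeff (C i i) n 0 + fourier_coeff (C j j) n 0) / 2)"
    by (intro summable_divide summable_add summable_fourier_coeff_diag ij)
  have "\<bar>fourier_coeff (C i j) n c\<bar> \<le> (fourier_coeff (C i i) n 0 + fourier_coeff (C j j) n 0) / 2" if "1 \<le> n" for n
  proof (rule LIMSEQ_le)
    show "(\<lambda>N. \<bar>cov_coeff n c N i j\<bar>) \<longlonglongrightarrow> \<bar>fourier_coeff (C i j) n c\<bar>"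
      by (intro tendsto_rabs cov_coeff_tendsto ij)
    show "(\<lambda>N. (cov_coeff n 0 N i i + cov_coeff n 0 N j j) / 2) \<longlonglongrightarrow> (fourier_coeff (C i i) n 0 + fourier_coeff (C j j) n 0) / 2"
      by (intro tendsto_divide tendsto_add cov_coeff_tendsto ij tendsto_const) simp
    show "\<exists>N0. \<forall>N\<ge>N0. \<bar>cov_coeff n c N i j\<bar> \<le> (cov_coeff n 0 N i i + cov_coeff n 0 N j j) / 2"
      using that by (intro exI[of _ "Suc (2 * n)"] allI impI abs_cov_coeff_le ij) auto
  qed
  then show "\<exists>N. \<forall>n\<ge>N. norm \<bar>fourier_coeff (C i j) n c\<bar> \<le> (fourier_coeff (C i i) n 0 + fourier_coeff (C j j) n 0) / 2"
    by auto
qed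

section \<open>Cosine coefficients of the covariance as covariances\<close>

text \<open>The limits stand for the random cosine coefficients of the paths, without integrating
  any path. For nested grids the mean square distance of two Riemann sums is a difference of numbers
  \<open>cov_coeff\<close>, up to a factor, so convergence of these numbers makes the Riemann sums
  Cauchy.\<close>

lemma ex_L2_fourier_coeff:
  obtains A where "\<And>i. i \<in> I \<Longrightarrow> square_integrable M (A i)" "\<And>i. i \<in> I \<Longrightarrow> (\<integral>\<omega>. A i \<omega> \<partial>M) = 0"
    "\<And>i j. i \<in> I \<Longrightarrow> j \<in> I \<Longrightarrow>
      (\<integral>\<omega>. A i \<omega> * A j \<omega> \<partial>M) = fourier_coeff (C i j) n 0 / fourier_weight n"
proof -
  \<comment> \<open>Powers of two make the grids nested.\<close>
  define N :: "nat \<Rightarrow> nat" where "N k = 2 ^ (k + n + 1)" for k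
  have N: "2 * n < N k" "0 < N k" "N k dvd N l" if "k \<le> l" for k l
  proof -
    \<comment> \<open>The summand \<open>n + 1\<close> in the exponent makes already the first grid
      resolve the frequency \<open>2 * n\<close>.\<close>
    have "n < 2 ^ n" by (rule less_exp)
    also have "\<dots> \<le> 2 ^ (k + n)" by (rule power_increasing) auto
    finally show "2 * n < N k" by (simp add: N_def)
    show "N k dvd N l" using that unfolding N_def by (intro le_imp_power_dvd) simp
  qed (simp add: N_def)
  have "strict_mono N" by (rule strict_monoI) (simp add: N_def)
  then have lim: "(\<lambda>k. cov_coeff n 0 (N k) i j) \<longlonglongrightarrow> fourier_coeff (C i j) n 0" if "i \<in> I" "j \<in> I" for i j
    using LIMSEQ_subseq_LIMSEQ[OF cov_coeff_tendsto[OF that]] by (simp add: o_def)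
  let ?X = "\<lambda>i k. field_coeff n 0 (N k) i"
  have w: "1 \<le> fourier_weight n" by (simp add: fourier_weight_def)
  have "\<exists>A. square_integrable M A \<and> (\<lambda>k. \<integral>\<omega>. (?X i k \<omega> - A \<omega>)\<^sup>2 \<partial>M) \<longlonglongrightarrow> 0" if i: "i \<in> I" for i
  proof -
    have mom: "(\<integral>\<omega>. ?X i l \<omega> * ?X i k \<omega> \<partial>M) = cov_coeff n 0 (N l) i i / fourier_weight n" if "k \<le> l" for k l
      using N that by (intro integral_field_coeff_times_phase_0 i) auto
    \<comment> \<open>The mixed moment equals the second moment on the finer grid, so the square
      expands to a plain difference.\<close>
    have diff: "(\<integral>\<omega>. (?X i l \<omega> - ?X i k \<omega>)\<^sup>2 \<partial>M) = (cov_coeff n 0 (N k) i i - cov_coeff n 0 (N l) i i) / fourier_weight n"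
      if "k \<le> l" for k l
      using integral_power2_diff_cmult[OF square_integrable_field_coeff[OF i] square_integrable_field_coeff[OF i],
          of n 0 "N l" 1 n 0 "N k"] mom[OF that] mom[of k k] mom[of l l]
      by (simp add: diff_divide_distrib)
    have cauchy: "\<exists>K. \<forall>k\<ge>K. \<forall>l\<ge>K. (\<integral>\<omega>. (?X i k \<omega> - ?X i l \<omega>)\<^sup>2 \<partial>M) < e" if "e > 0" for e
    proof -
      from LIMSEQ_imp_Cauchy[OF lim[OF i i]] \<open>e > 0\<close> obtain K where
        K: "\<And>k l. k \<ge> K \<Longrightarrow> l \<ge> K \<Longrightarrow> \<bar>cov_coeff n 0 (N k) i i - cov_coeff n 0 (N l) i i\<bar> < e"
        unfolding Cauchy_def dist_real_def by metis
      have ordered: "(\<integral>\<omega>. (?X i l \<omega> - ?X i k \<omega>)\<^sup>2 \<partial>M) < e" if "k \<ge> K" "l \<ge> K" "k \<le> l" for k l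
      proof -
        have "(\<integral>\<omega>. (?X i l \<omega> - ?X i k \<omega>)\<^sup>2 \<partial>M) \<le> \<bar>cov_coeff n 0 (N k) i i - cov_coeff n 0 (N l) i i\<bar> / fourier_weight n"
          unfolding diff[OF that(3)] using w by (intro divide_right_mono) auto
        also have "\<dots> \<le> \<bar>cov_coeff n 0 (N k) i i - cov_coeff n 0 (N l) i i\<bar> / 1"
          using w by (intro divide_left_mono) auto
        finally show ?thesis using K[OF that(1,2)] by simp
      qed
      have "(\<integral>\<omega>. (?X i k \<omega> - ?X i l \<omega>)\<^sup>2 \<partial>M) < e" if "k \<ge> K" "l \<ge> K" for k l
      proof (cases "k \<le> l")
        case True
        have "(\<integral>\<omega>. (?X i k \<omega> - ?X i l \<omega>)\<^sup>2 \<partial>M) = (\<integral>\<omega>. (?X i l \<omega> - ?X i k \<omega>)\<^sup>2 \<partial>M)"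
          by (rule Bochner_Integration.integral_cong[OF refl power2_commute])
        then show ?thesis using ordered[OF that True] by (rule ord_eq_less_trans)
      next
        case False
        then show ?thesis using ordered[OF that(2,1)] by simp
      qed
      then show ?thesis by blast
    qed
    show ?thesis
      by (rule L2_complete[of "?X i"], rule square_integrable_field_coeff[OF i], erule cauchy, intro exI conjI)
  qed
  then have "\<forall>i\<in>I. \<exists>A. square_integrable M A \<and> (\<lambda>k. \<integral>\<omega>. (?X i k \<omega> - A \<omega>)\<^sup>2 \<partial>M) \<longlonglongrightarrow> 0"
    by (rule ballI)
  from bchoice[OF this] obtain A where
    "\<forall>i\<in>I. square_integrable M (A i) \<and> (\<lambda>k. \<integral>\<omega>. (?X i k \<omega> - A i \<omega>)\<^sup>2 \<partial>M) \<longlonglongrightarrow> 0" ..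
  note conv = bspec[OF this]
  note A = conv[THEN conjunct1] conv[THEN conjunct2]
  show thesis
  proof (rule that[OF A(1)])
    fix i assume i: "i \<in> I"
    \<comment> \<open>Means are inner products with the constant \<open>1\<close>, so they pass to
      the limit as well.\<close>
    have "(\<lambda>k. \<integral>\<omega>. ?X i k \<omega> * 1 \<partial>M) \<longlonglongrightarrow> (\<integral>\<omega>. A i \<omega> * 1 \<partial>M)"
      by (rule tendsto_integral_times[OF _ _ A(1)[OF i] square_integrable_const A(2)[OF i]])
        (simp_all add: square_integrable_field_coeff square_integrable_const i)
    then show "(\<integral>\<omega>. A i \<omega> \<partial>M) = 0"
      using mean_field_coeff[OF i] by (simp add: LIMSEQ_const_iff)
    fix j assume j: "j \<in> I"
    have "(\<lambda>k. \<integral>\<omega>. ?X i k \<omega> * ?X j k \<omega> \<partial>M) \<longlonglongrightarrow> (\<integral>\<omega>. A i \<omega> * A j \<omega> \<partial>M)"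
      by (rule tendsto_integral_times[OF _ _ A(1)[OF i] A(1)[OF j] A(2)[OF i] A(2)[OF j]])
        (simp_all add: square_integrable_field_coeff i j)
    moreover have "(\<integral>\<omega>. ?X i k \<omega> * ?X j k \<omega> \<partial>M) = cov_coeff n 0 (N k) i j / fourier_weight n" for k
      using N by (intro integral_field_coeff_times_phase_0 i j) auto
    moreover have "(\<lambda>k. cov_coeff n 0 (N k) i j / fourier_weight n) \<longlonglongrightarrow> fourier_coeff (C i j) n 0 / fourier_weight n"
      using w by (intro tendsto_divide lim i j tendsto_const) auto
    ultimately show "(\<integral>\<omega>. A i \<omega> * A j \<omega> \<partial>M) = fourier_coeff (C i j) n 0 / fourier_weight n"
      using LIMSEQ_unique by (simp only:) blast
  qed
qed

lemma covariance_function_fourier_coeff: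
  "covariance_function_on I (\<lambda>i j. fourier_weight n * fourier_coeff (C i j) n 0)"
proof -
  obtain A where A: "\<And>i. i \<in> I \<Longrightarrow> square_integrable M (A i)" "\<And>i. i \<in> I \<Longrightarrow> (\<integral>\<omega>. A i \<omega> \<partial>M) = 0"
    "\<And>i j. i \<in> I \<Longrightarrow> j \<in> I \<Longrightarrow>
      (\<integral>\<omega>. A i \<omega> * A j \<omega> \<partial>M) = fourier_coeff (C i j) n 0 / fourier_weight n"
    by (rule ex_L2_fourier_coeff[of n]) (rule that)
  \<comment> \<open>Scaling multiplies moments by the square of the weight and thus turns the
    divisor \<open>fourier_weight n\<close> into a factor.\<close>
  define X where "X i \<omega> = fourier_weight n * A i \<omega>" for i \<omega>
  show ?thesis
  proof (rule covariance_function_onI)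
    have "square_integrable M (X i)" if "i \<in> I" for i
      unfolding X_def[abs_def] by (intro square_integrable_cmult A that)
    then show "second_order_process M I X"
      using prob_space_axioms by (auto simp: second_order_process_def square_integrable_def)
    fix i j assume ij: "i \<in> I" "j \<in> I"
    have "covariance M (X i) (X j) = (\<integral>\<omega>. (fourier_weight n)\<^sup>2 * (A i \<omega> * A j \<omega>) \<partial>M)"
      unfolding covariance_def X_def using A(2) ij by (simp add: power2_eq_square mult_ac)
    also have "\<dots> = fourier_weight n * fourier_coeff (C i j) n 0"
      using A(3)[OF ij] by (simp add: fourier_weight_def power2_eq_square)
    finally show "fourier_weight n * fourier_coeff (C i j) n 0 = covariance M (X i) (X j)" by simp
  qed
qed

lemma C_sums:
  assumes ij: "i \<in> I" "j \<in> I" and t: "t \<in> {- (2 * pi)..2 * pi}"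
  shows "(\<lambda>n. fourier_weight n * fourier_coeff (C i j) n 0 * cos (real n * t)
      + fourier_weight n * fourier_coeff (C i j) n (- (pi / 2)) * sin (real n * t)) sums C i j t"
proof -
  have nonneg: "(\<lambda>n. fourier_weight n * fourier_coeff (C i j) n 0 * cos (real n * t)
      + fourier_weight n * fourier_coeff (C i j) n (- (pi / 2)) * sin (real n * t)) sums C i j t"
    if "t \<in> {0..2 * pi}" for t
    by (rule Fourier_series_sums[OF cont[OF ij] _ summable_abs_fourier_coeff[OF ij] that])
      (use C_periodic[OF ij, of "2 * pi"] in simp)
  show ?thesis
  proof (cases "0 \<le> t")
    case True
    then show ?thesis using nonneg t by simp
  next
    case False
    \<comment> \<open>Negative arguments are moved up by one period, where both \<open>C\<close> and
      the series are unchanged.\<close>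
    have "C i j t = C i j (t + 2 * pi)"
      using C_periodic[OF ij, of "t + 2 * pi"] False t by simp
    moreover have "cos (real n * (t + 2 * pi)) = cos (real n * t)" "sin (real n * (t + 2 * pi)) = sin (real n * t)" for n
      using cos.plus_of_nat[of "real n * t" n] sin.plus_of_nat[of "real n * t" n] by (simp_all add: distrib_left)
    ultimately show ?thesis using nonneg[of "t + 2 * pi"] False t by simp
  qed
qed

end

section \<open>Axially symmetric fields on the sphere\<close>

lemma sphere_point_in_sphere:
  "\<phi> \<in> {0..pi} \<Longrightarrow> \<theta> \<in> {0..2 * pi} \<Longrightarrow> sphere_point \<phi> \<theta> \<in> sphere 0 1"
  unfolding image_sphere_point[symmetric] by auto

text \<open>Continuity of \<open>C \<phi>1 \<phi>2\<close> is the substantial condition: its value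
  at \<open>t\<close> is the moment of the centred field at longitude \<open>t\<close> on one
  parallel and at longitude \<open>0\<close> on the other, and only the first factor moves.\<close>

lemma circle_fields_centred:
  assumes Z: "second_order_process M (sphere 0 1) Z"
    and sym: "axially_symmetric M Z"
    and ms: "mean_square_continuous M Z"
    and C: "axial_covariance M Z C"
  shows "circle_fields M {0..pi}
    (\<lambda>\<phi> \<theta> \<omega>. Z (sphere_point \<phi> \<theta>) \<omega> - integral\<^sup>L M (Z (sphere_point \<phi> \<theta>))) C"
proof -
  interpret prob_space M using Z by (simp add: second_order_process_def)
  let ?Z = "\<lambda>\<phi> \<theta>. Z (sphere_point \<phi> \<theta>)"
  define Y where "Y \<phi> \<theta> \<omega> = ?Z \<phi> \<theta> \<omega> - integral\<^sup>L M (?Z \<phi> \<theta>)" for \<phi> \<theta> \<omega>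
  have sqZ: "square_integrable M (?Z \<phi> \<theta>)" if "\<phi> \<in> {0..pi}" "\<theta> \<in> {0..2 * pi}" for \<phi> \<theta>
    using Z sphere_point_in_sphere[OF that] by (simp add: second_order_process_def square_integrable_def)
  have sqY: "square_integrable M (Y \<phi> \<theta>)" if "\<phi> \<in> {0..pi}" "\<theta> \<in> {0..2 * pi}" for \<phi> \<theta>
    unfolding Y_def[abs_def] by (intro square_integrable_diff square_integrable_const sqZ that)
  have covY: "(\<integral>\<omega>. Y \<phi>1 \<theta>1 \<omega> * Y \<phi>2 \<theta>2 \<omega> \<partial>M) = C \<phi>1 \<phi>2 (\<theta>1 - \<theta>2)"
    if "\<phi>1 \<in> {0..pi}" "\<phi>2 \<in> {0..pi}" "\<theta>1 \<in> {0..2 * pi}" "\<theta>2 \<in> {0..2 * pi}" for \<phi>1 \<phi>2 \<theta>1 \<theta>2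
    using C that unfolding axial_covariance_def covariance_def Y_def by blast
  have contY: "((\<lambda>s. \<integral>\<omega>. (Y \<phi> s \<omega> - Y \<phi> t \<omega>)\<^sup>2 \<partial>M) \<longlongrightarrow> 0) (at t within {0..2 * pi})"
    if \<phi>: "\<phi> \<in> {0..pi}" and t: "t \<in> {0..2 * pi}" for \<phi> t
  proof -
    \<comment> \<open>By axial symmetry the mean is constant along the parallel, so centring does
      not alter the increments.\<close>
    obtain m where m: "\<And>\<theta>. \<theta> \<in> {0..2 * pi} \<Longrightarrow> integral\<^sup>L M (?Z \<phi> \<theta>) = m"
      using sym \<phi> unfolding axially_symmetric_def by metis
    have "((\<lambda>(\<phi>1, \<theta>1). \<integral>\<omega>. \<bar>?Z \<phi>1 \<theta>1 \<omega> - ?Z \<phi> t \<omega>\<bar>\<^sup>2 \<partial>M) \<longlongrightarrow> 0)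
        (at (\<phi>, t) within {0..pi} \<times> {0..2 * pi})"
      using ms \<phi> t unfolding mean_square_continuous_def by blast
    \<comment> \<open>The joint limit is restricted to an approach along the fixed latitude.\<close>
    moreover have "filterlim (Pair \<phi>) (at (\<phi>, t) within {0..pi} \<times> {0..2 * pi}) (at t within {0..2 * pi})"
      using \<phi> by (auto simp: filterlim_at eventually_at_filter intro!: tendsto_intros)
    ultimately have "((\<lambda>s. \<integral>\<omega>. \<bar>?Z \<phi> s \<omega> - ?Z \<phi> t \<omega>\<bar>\<^sup>2 \<partial>M) \<longlongrightarrow> 0) (at t within {0..2 * pi})"
      by (auto dest: filterlim_compose)
    moreover have "eventually (\<lambda>s. (\<integral>\<omega>. \<bar>?Z \<phi> s \<omega> - ?Z \<phi> t \<omega>\<bar>\<^sup>2 \<partial>M) = (\<integral>\<omega>. (Y \<phi> s \<omega> - Y \<phi> t \<omega>)\<^sup>2 \<partial>M))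
        (at t within {0..2 * pi})"
      unfolding eventually_at_filter by (rule always_eventually) (simp add: Y_def m m[OF t])
    ultimately show ?thesis by (rule Lim_transform_eventually)
  qed
  have "circle_fields M {0..pi} Y C"
  proof
    fix \<phi>1 \<phi>2 assume \<phi>: "\<phi>1 \<in> {0..pi}" "\<phi>2 \<in> {0..pi}"
    show "Y \<phi>1 (2 * pi) = Y \<phi>1 0" by (simp add: Y_def sphere_point_def fun_eq_iff)
    have zero: "0 \<in> {0..2 * pi}" by simp
    have "((\<lambda>s. \<integral>\<omega>. Y \<phi>1 s \<omega> * Y \<phi>2 0 \<omega> \<partial>M) \<longlongrightarrow> (\<integral>\<omega>. Y \<phi>1 t \<omega> * Y \<phi>2 0 \<omega> \<partial>M)) (at t within {0..2 * pi})"
      if t: "t \<in> {0..2 * pi}" for t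
      by (rule tendsto_integral_times[OF _ _ sqY[OF \<phi>(1) t] sqY[OF \<phi>(2) zero] contY[OF \<phi>(1) t]])
        (auto simp: eventually_at_filter intro!: always_eventually sqY[OF \<phi>(1)] sqY[OF \<phi>(2)])
    then have "continuous_on {0..2 * pi} (\<lambda>t. \<integral>\<omega>. Y \<phi>1 t \<omega> * Y \<phi>2 0 \<omega> \<partial>M)"
      by (simp add: continuous_on_def)
    then show "continuous_on {0..2 * pi} (C \<phi>1 \<phi>2)"
      by (rule continuous_on_cong[THEN iffD1, rotated -1]) (use covY[OF \<phi> _ zero] in auto)
  next
    fix \<phi> \<theta> assume "\<phi> \<in> {0..pi}" "\<theta> \<in> {0..2 * pi}"
    from sqZ[OF this] have "integrable M (?Z \<phi> \<theta>)"
      using square_integrable_imp_integrable by (auto simp: square_integrable_def)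
    then show "(\<integral>\<omega>. Y \<phi> \<theta> \<omega> \<partial>M) = 0" by (simp add: Y_def prob_space)
  qed (use sqY covY in auto)
  then show ?thesis by (simp only: Y_def[abs_def])
qed

theorem theorem1:
  fixes M :: "'w measure"
    and Z :: "real^3 \<Rightarrow> 'w \<Rightarrow> real"
    and C :: "real \<Rightarrow> real \<Rightarrow> real \<Rightarrow> real"
  assumes "second_order_process M (sphere 0 1) Z"
    and "axially_symmetric M Z"
    and "mean_square_continuous M Z"
    and "axial_covariance M Z C"
  shows "\<exists>b a :: nat \<Rightarrow> real \<Rightarrow> real \<Rightarrow> real.
    (\<forall>\<phi>1\<in>{0..pi}. \<forall>\<phi>2\<in>{0..pi}. \<forall>\<theta>\<in>{- (2 * pi)..2 * pi}.
       (\<lambda>n. b n \<phi>1 \<phi>2 * cos (real n * \<theta>) + a n \<phi>1 \<phi>2 * sin (real n * \<theta>)) sums C \<phi>1 \<phi>2 \<theta>) \<and>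
    (\<forall>n. covariance_function_on {0..pi} (b n)) \<and>
    (\<forall>\<phi>1\<in>{0..pi}. \<forall>\<phi>2\<in>{0..pi}. summable (\<lambda>n. b n \<phi>1 \<phi>2))"
proof -
  interpret circle_fields M "{0..pi}"
    "\<lambda>\<phi> \<theta> \<omega>. Z (sphere_point \<phi> \<theta>) \<omega> - integral\<^sup>L M (Z (sphere_point \<phi> \<theta>))" C
    using assms by (rule circle_fields_centred)
  define b where "b n \<phi>1 \<phi>2 = fourier_weight n * fourier_coeff (C \<phi>1 \<phi>2) n 0" for n \<phi>1 \<phi>2
  define a where "a n \<phi>1 \<phi>2 = fourier_weight n * fourier_coeff (C \<phi>1 \<phi>2) n (- (pi / 2))" for n \<phi>1 \<phi>2
  have sums: "(\<lambda>n. b n \<phi>1 \<phi>2 * cos (real n * \<theta>) + a n \<phi>1 \<phi>2 * sin (real n * \<theta>)) sums C \<phi>1 \<phi>2 \<theta>"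
    if "\<phi>1 \<in> {0..pi}" "\<phi>2 \<in> {0..pi}" "\<theta> \<in> {- (2 * pi)..2 * pi}" for \<phi>1 \<phi>2 \<theta>
    unfolding a_def b_def using that by (rule C_sums)
  moreover have "covariance_function_on {0..pi} (b n)" for n
    unfolding b_def[abs_def] by (rule covariance_function_fourier_coeff)
  moreover have "summable (\<lambda>n. b n \<phi>1 \<phi>2)" if "\<phi>1 \<in> {0..pi}" "\<phi>2 \<in> {0..pi}" for \<phi>1 \<phi>2
    \<comment> \<open>At longitude difference \<open>0\<close> the sines vanish and the cosines are
      \<open>1\<close>, which leaves the series of the \<open>b n\<close>.\<close>
    using sums_summable[OF sums[OF that, of 0]] by simp
  ultimately show ?thesis by blast
qed

end
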